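(* Let $G$ be a snake graph, coloured so that all its turns are black, and let $w$ be any Kasteleyn weighting of $G$ with weighted adjacency matrix $A$ and weighted bipartite adjacency matrix $B$. Let $B_1$ (resp. $B_2$) be the principal submatrix of $BB^T$ on the black vertices of the upper (resp. lower) boundary. Then $\chi_A(t)=\chi_{B_1}(t^2)\chi_{B_2}(t^2)$. Moreover, if $1,2,\dots,k$ are the black vertices of the upper boundary in the order they occur along it, $e_l$ is the number of neighbours of vertex $l$ in $G$, and $c_l(x)=x-e_l$, then $\chi_{B_1}(x)=p(x)$, where $$[[c_1(x),\dots,c_k(x)]]=c_1(x)-\cfrac{1}{c_2(x)-\cfrac{1}{\ddots-\cfrac{1}{c_k(x)}}}=\frac{p(x)}{q(x)}$$ with $p,q\in\mathbb{Q}[x]$ coprime and $p$ monic. The polynomial $\chi_{B_2}(x)$ is obtained in the same way from the black vertices of the lower boundary.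
   Context: A snake graph is a plane graph formed by a finite sequence of unit square tiles $T_1,\dots,T_N$ in the plane, each $T_{i+1}$ placed immediately to the right of or immediately on top of $T_i$, consecutive tiles sharing exactly one edge. It is bipartite; vertices are coloured black and white with adjacent vertices of different colours. A vertex is a turn if it has exactly $2$ or exactly $4$ neighbours and is neither the lower-right, lower-left nor upper-left vertex of $T_1$, nor the upper-left, upper-right or lower-right vertex of $T_N$. Upper and lower boundary: for $N\geq2$, the start edge is the edge of $T_1$ joining the two vertices of $T_1$ not in any other tile, and the end edge is defined analogously for $T_N$; the edges bounding the unbounded face form a cycle, and removing the start and end edges leaves two disjoint paths; the one containing the lower-left vertex of $T_1$ is the upper boundary if $T_2$ lies above $T_1$ and the lower boundary otherwise, the other path being the other boundary. For $N=1$ the upper boundary is the top edge and the lower boundary is the bottom edge. A weighting $w:E\to\{\pm1\}$ is Kasteleyn if every face (including the unbounded face) bounded by a $k$-cycle has an odd number of edges of weight $-1$ when $k\equiv0\bmod4$ and an even number when $k\equiv2\bmod4$. The weighted adjacency matrix $A$ is indexed by all vertices with entry $w(e)$ for vertices joined by edge $e$ and $0$ otherwise; $B$ is its submatrix with rows the black and columns the white vertices. $\chi_M(x)=\det(xI-M)$. *)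

theory Defs
  imports
    "Jordan_Normal_Form.Char_Poly"
    "Jordan_Normal_Form.DL_Submatrix"
    "HOL-Computational_Algebra.Computational_Algebra"
begin

text \<open>Tiles are unit squares with corners in \<open>\<int>\<^sup>2\<close> (no generality is lost, up to a translation of the
  plane); a tile is represented by its lower-left corner.\<close>

type_synonym vertex = "int \<times> int"
type_synonym edge = "vertex set"

definition lower_left :: "int \<times> int \<Rightarrow> vertex" where
  "lower_left t = t"

definition lower_right :: "int \<times> int \<Rightarrow> vertex" where
  "lower_right t = (fst t + 1, snd t)"

definition upper_left :: "int \<times> int \<Rightarrow> vertex" where
  "upper_left t = (fst t, snd t + 1)"

definition upper_right :: "int \<times> int \<Rightarrow> vertex" where
  "upper_right t = (fst t + 1, snd t + 1)"

definition tile_vertices :: "int \<times> int \<Rightarrow> vertex set" where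
  "tile_vertices t = {lower_left t, lower_right t, upper_left t, upper_right t}"

definition tile_edges :: "int \<times> int \<Rightarrow> edge set" where
  "tile_edges t =
     {{lower_left t, lower_right t}, {upper_left t, upper_right t},
      {lower_left t, upper_left t}, {lower_right t, upper_right t}}"

definition right_of :: "int \<times> int \<Rightarrow> int \<times> int" where
  "right_of t = (fst t + 1, snd t)"

definition above :: "int \<times> int \<Rightarrow> int \<times> int" where
  "above t = (fst t, snd t + 1)"

text \<open>The tile \<open>T\<^sub>i\<close> is \<open>T ! (i - 1)\<close>.\<close>

definition snake :: "(int \<times> int) list \<Rightarrow> bool" where
  "snake T \<longleftrightarrow> T \<noteq> [] \<and>
     (\<forall>i. Suc i < length T \<longrightarrow> T ! Suc i = right_of (T ! i) \<or> T ! Suc i = above (T ! i))"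

definition verts :: "(int \<times> int) list \<Rightarrow> vertex set" where
  "verts T = (\<Union>t\<in>set T. tile_vertices t)"

definition edges :: "(int \<times> int) list \<Rightarrow> edge set" where
  "edges T = (\<Union>t\<in>set T. tile_edges t)"

definition num_neighbours :: "(int \<times> int) list \<Rightarrow> vertex \<Rightarrow> nat" where
  "num_neighbours T v = card {u \<in> verts T. {u, v} \<in> edges T}"

definition is_turn :: "(int \<times> int) list \<Rightarrow> vertex \<Rightarrow> bool" where
  "is_turn T v \<longleftrightarrow> v \<in> verts T \<and> num_neighbours T v \<in> {2, 4} \<and>
     v \<notin> {lower_right (hd T), lower_left (hd T), upper_left (hd T)} \<and>
     v \<notin> {upper_left (last T), upper_right (last T), lower_right (last T)}"

definition proper_colouring :: "(int \<times> int) list \<Rightarrow> (vertex \<Rightarrow> bool) \<Rightarrow> bool" where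
  "proper_colouring T black \<longleftrightarrow>
     (\<forall>u\<in>verts T. \<forall>v\<in>verts T. {u, v} \<in> edges T \<longrightarrow> black u \<noteq> black v)"


text \<open>The bounded faces are the tiles, so an edge has the unbounded face on one of its sides iff it
  belongs to exactly one tile.\<close>

definition outer_edges :: "(int \<times> int) list \<Rightarrow> edge set" where
  "outer_edges T = {e \<in> edges T. \<exists>!t. t \<in> set T \<and> e \<in> tile_edges t}"

definition face_boundaries :: "(int \<times> int) list \<Rightarrow> edge set set" where
  "face_boundaries T = insert (outer_edges T) (tile_edges ` set T)"

definition kasteleyn :: "(int \<times> int) list \<Rightarrow> (edge \<Rightarrow> rat) \<Rightarrow> bool" where
  "kasteleyn T w \<longleftrightarrow> (\<forall>e\<in>edges T. w e \<in> {1, -1}) \<and>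
     (\<forall>F\<in>face_boundaries T.
        (card F mod 4 = 0 \<longrightarrow> odd (card {e \<in> F. w e = -1})) \<and>
        (card F mod 4 = 2 \<longrightarrow> even (card {e \<in> F. w e = -1})))"


text \<open>As an edge is the set of its two ends, for at least two tiles the following are edges.\<close>

definition start_edge :: "(int \<times> int) list \<Rightarrow> edge" where
  "start_edge T = {v \<in> tile_vertices (hd T). \<forall>t\<in>set T - {hd T}. v \<notin> tile_vertices t}"

definition end_edge :: "(int \<times> int) list \<Rightarrow> edge" where
  "end_edge T = {v \<in> tile_vertices (last T). \<forall>t\<in>set T - {last T}. v \<notin> tile_vertices t}"

definition path_edges :: "vertex list \<Rightarrow> edge set" where
  "path_edges ps = {{ps ! i, ps ! Suc i} | i. Suc i < length ps}"

text \<open>\<open>boundary_paths T us ls\<close>: the vertex lists \<open>us\<close> and \<open>ls\<close> traverse the upper and the lower boundary,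
  each from one of its two ends to the other. The direction of traversal is left open.\<close>

definition boundary_paths :: "(int \<times> int) list \<Rightarrow> vertex list \<Rightarrow> vertex list \<Rightarrow> bool" where
  "boundary_paths T us ls \<longleftrightarrow>
     distinct us \<and> distinct ls \<and> set us \<inter> set ls = {} \<and>
     (if length T = 1
      then path_edges us = {{upper_left (hd T), upper_right (hd T)}} \<and>
           path_edges ls = {{lower_left (hd T), lower_right (hd T)}}
      else path_edges us \<union> path_edges ls = outer_edges T - {start_edge T, end_edge T} \<and>
           lower_left (hd T) \<in> set (if T ! 1 = above (hd T) then us else ls))"


text \<open>Matrices are indexed by numbers, so that the vertices are enumerated by a list \<open>vs\<close>. The black
  vertices, which index the rows of \<open>B\<close> and of \<open>B B\<^sup>T\<close>, then get enumerated by \<open>filter black vs\<close>.\<close>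

definition weighted_adj_mat :: "(int \<times> int) list \<Rightarrow> (edge \<Rightarrow> rat) \<Rightarrow> vertex list \<Rightarrow> rat mat" where
  "weighted_adj_mat T w vs = mat (length vs) (length vs)
     (\<lambda>(i, j). if {vs ! i, vs ! j} \<in> edges T then w {vs ! i, vs ! j} else 0)"

definition bipartite_adj_mat ::
  "(int \<times> int) list \<Rightarrow> (vertex \<Rightarrow> bool) \<Rightarrow> (edge \<Rightarrow> rat) \<Rightarrow> vertex list \<Rightarrow> rat mat" where
  "bipartite_adj_mat T black w vs = submatrix (weighted_adj_mat T w vs)
     {i. i < length vs \<and> black (vs ! i)} {j. j < length vs \<and> \<not> black (vs ! j)}"

definition boundary_gram_mat ::
  "(int \<times> int) list \<Rightarrow> (vertex \<Rightarrow> bool) \<Rightarrow> (edge \<Rightarrow> rat) \<Rightarrow> vertex list \<Rightarrow> vertex list \<Rightarrow> rat mat" where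
  "boundary_gram_mat T black w vs ps =
     (let B = bipartite_adj_mat T black w vs;
          bs = filter black vs;
          I = {i. i < length bs \<and> bs ! i \<in> set ps}
      in submatrix (B * transpose_mat B) I I)"


text \<open>The value for the empty list is a dummy.\<close>

fun neg_cfrac :: "'a::field list \<Rightarrow> 'a" where
  "neg_cfrac [] = 0"
| "neg_cfrac [c] = c"
| "neg_cfrac (c # d # cs) = c - 1 / neg_cfrac (d # cs)"

definition c_poly :: "(int \<times> int) list \<Rightarrow> vertex \<Rightarrow> rat poly" where
  "c_poly T l = [:- of_nat (num_neighbours T l), 1:]"

definition boundary_cfrac ::
  "(int \<times> int) list \<Rightarrow> (vertex \<Rightarrow> bool) \<Rightarrow> vertex list \<Rightarrow> rat poly fract" where
  "boundary_cfrac T black ps = neg_cfrac (map (\<lambda>l. to_fract (c_poly T l)) (filter black ps))"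

definition lowest_terms :: "rat poly fract \<Rightarrow> rat poly \<Rightarrow> rat poly \<Rightarrow> bool" where
  "lowest_terms r p q \<longleftrightarrow> q \<noteq> 0 \<and> r = Fract p q \<and> coprime p q \<and> lead_coeff p = 1"

end

theory Submission
  imports Defs
begin

text \<open>Write \<open>A\<close> in blocks \<open>0, B, B\<^sup>T, 0\<close>. Since the two colour classes have the same size,
  \<open>\<chi>\<^sub>A(t)\<close> is the characteristic polynomial of \<open>B B\<^sup>T\<close> at \<open>t\<^sup>2\<close>. An off-diagonal entry of \<open>B B\<^sup>T\<close> sums
  over the common white neighbours \<open>x\<close> of two black vertices. As \<open>x\<close> is not a turn, the two vertices
  either are opposite in a tile, and the Kasteleyn condition cancels the two contributions, or they lie
  in a straight line with \<open>x\<close> between them, and then both steps run along one and the same boundary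
  path. So \<open>B B\<^sup>T\<close> splits into the blocks of the two boundaries, each of them tridiagonal with entries
  \<open>1\<close> or \<open>-1\<close> next to the diagonal, whose characteristic polynomials are continuants; consecutive
  continuants are coprime and form the numerator and denominator of the continued fraction.\<close>

text \<open>The geometry is kept local: whether a segment at a lattice point \<open>(a, b)\<close>
  is an edge or a rail becomes a propositional condition on which nearby unit squares are tiles. The
  one global input is that the coordinate sum grows by 1 from tile to tile, so an antidiagonal holds
  at most one tile; this also lets the first and the last tile be recognised by missing neighbours.
  The delicate vertices are the corners of these two tiles: they may be white although they have
  degree 2, but there one of the two edges is the start or the end edge (for one tile, a vertical
  edge), so the rails still never bend at a white vertex. Since \<open>boundary_paths\<close>
  prescribes edge sets only, it has to be derived that the two lists contain all vertices and no
  others before the black rows can be sorted along them. The weights disappear from the result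
  because they square to 1, which makes the diagonal entries degrees, and because only products of
  mirror entries enter a tridiagonal determinant.\<close>

section \<open>Matrices indexed by lists\<close>

text \<open>Indexing by labels turns submatrices, reorderings and block decompositions into list
  operations: \<open>nths\<close>, permutation and append.\<close>

definition list_mat :: "('a \<Rightarrow> 'a \<Rightarrow> 'b) \<Rightarrow> 'a list \<Rightarrow> 'a list \<Rightarrow> 'b mat" where
  "list_mat f xs ys = mat (length xs) (length ys) (\<lambda>(i, j). f (xs ! i) (ys ! j))"

lemma dim_list_mat [simp]:
  "dim_row (list_mat f xs ys) = length xs" "dim_col (list_mat f xs ys) = length ys"
  by (simp_all add: list_mat_def)

lemma list_mat_carrier [simp]: "list_mat f xs ys \<in> carrier_mat (length xs) (length ys)"
  by (simp add: list_mat_def)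

lemma index_list_mat [simp]:
  "i < length xs \<Longrightarrow> j < length ys \<Longrightarrow> list_mat f xs ys $$ (i, j) = f (xs ! i) (ys ! j)"
  by (simp add: list_mat_def)

lemma submatrix_list_mat: "submatrix (list_mat f xs ys) I J = list_mat f (nths xs I) (nths ys J)"
proof (rule eq_matI)
  fix i j
  assume "i < dim_row (list_mat f (nths xs I) (nths ys J))"
    and "j < dim_col (list_mat f (nths xs I) (nths ys J))"
  then have i: "i < card {i. i < length xs \<and> i \<in> I}" and j: "j < card {i. i < length ys \<and> i \<in> J}"
    by (simp_all add: length_nths)
  then have "pick I i < length xs" "pick J j < length ys"
    using pick_le by blast+
  with i j show "submatrix (list_mat f xs ys) I J $$ (i, j) = list_mat f (nths xs I) (nths ys J) $$ (i, j)"
    by (simp add: submatrix_index length_nths nth_nths)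
qed (simp_all add: dim_submatrix length_nths)

lemma list_mat_mult_transpose:
  fixes f :: "'a \<Rightarrow> 'a \<Rightarrow> 'b :: comm_semiring_1"
  assumes "distinct ys"
  shows "list_mat f xs ys * transpose_mat (list_mat f xs ys)
    = list_mat (\<lambda>u v. \<Sum>y\<in>set ys. f u y * f v y) xs xs"
proof (rule eq_matI)
  fix i j
  assume "i < dim_row (list_mat (\<lambda>u v. \<Sum>y\<in>set ys. f u y * f v y) xs xs)"
    and "j < dim_col (list_mat (\<lambda>u v. \<Sum>y\<in>set ys. f u y * f v y) xs xs)"
  then have i: "i < length xs" and j: "j < length xs" by simp_all
  have bij: "bij_betw ((!) ys) {0..<length ys} (set ys)"
    using bij_betw_nth[OF assms] by (simp add: atLeast0LessThan)
  show "(list_mat f xs ys * transpose_mat (list_mat f xs ys)) $$ (i, j)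
    = list_mat (\<lambda>u v. \<Sum>y\<in>set ys. f u y * f v y) xs xs $$ (i, j)"
    using i j by (simp add: scalar_prod_def sum.reindex_bij_betw[OF bij, symmetric])
qed simp_all

text \<open>One permutation acts on rows and on columns, so its sign enters twice and
  cancels.\<close>

lemma det_list_mat_perm:
  fixes f :: "'a \<Rightarrow> 'a \<Rightarrow> 'b :: idom"
  assumes "mset xs = mset ys"
  shows "det (list_mat f xs xs) = det (list_mat f ys ys)"
proof -
  obtain p where p: "p permutes {..<length ys}" and xs: "permute_list p ys = xs"
    using mset_eq_permutation[OF assms] by blast
  let ?n = "length ys"
  have len: "length xs = ?n" using xs by auto
  have p0: "p permutes {0..<?n}" using p by (simp add: atLeast0LessThan)
  have pn: "p i < ?n" if "i < ?n" for i using permutes_in_image[OF p, of i] that by simp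
  have nth: "xs ! i = ys ! p i" if "i < ?n" for i
    using xs permute_list_nth[OF p that] by simp
  \<comment> \<open>Only the rows are permuted in \<open>C\<close>; the columns follow by applying
    the row rule to its transpose.\<close>
  define C where "C = list_mat f xs ys"
  have "det C = det (mat ?n ?n (\<lambda>(i, j). list_mat f ys ys $$ (p i, j)))"
    by (rule arg_cong[where f = det]) (auto simp: C_def len nth pn intro!: eq_matI)
  also have "\<dots> = signof p * det (list_mat f ys ys)"
    by (rule det_permute_rows[OF _ p0]) simp
  finally have C: "det C = signof p * det (list_mat f ys ys)" .
  have Cc: "C \<in> carrier_mat ?n ?n" by (metis C_def len list_mat_carrier)
  have "det (list_mat f xs xs) = det (transpose_mat (list_mat f xs xs))"
    by (rule det_transpose[symmetric, OF list_mat_carrier])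
  also have "\<dots> = det (mat ?n ?n (\<lambda>(i, j). transpose_mat C $$ (p i, j)))"
    by (rule arg_cong[where f = det]) (auto simp: C_def len nth pn intro!: eq_matI)
  also have "\<dots> = signof p * det (transpose_mat C)"
    by (rule det_permute_rows[OF _ p0]) (use Cc in simp)
  also have "\<dots> = signof p * (signof p * det (list_mat f ys ys))"
    using det_transpose[OF Cc] C by simp
  also have "\<dots> = det (list_mat f ys ys)"
    by (simp add: sign_def)
  finally show ?thesis .
qed

text \<open>These are the entries of the characteristic matrix, with the diagonal recognised by
  equal labels; this agrees with equal positions only for distinct lists.\<close>

definition char_entry :: "('a \<Rightarrow> 'a \<Rightarrow> 'b :: comm_ring_1) \<Rightarrow> 'a \<Rightarrow> 'a \<Rightarrow> 'b poly" where
  "char_entry f u v = (if u = v then [:- f u u, 1:] else [:- f u v:])"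

lemma char_poly_matrix_list_mat:
  assumes "distinct xs"
  shows "char_poly_matrix (list_mat f xs xs) = list_mat (char_entry f) xs xs"
  using assms
  by (intro eq_matI) (auto simp: char_poly_matrix_def char_entry_def nth_eq_iff_index_eq)

lemma char_poly_list_mat:
  "distinct xs \<Longrightarrow> char_poly (list_mat f xs xs) = det (list_mat (char_entry f) xs xs)"
  by (simp add: char_poly_def char_poly_matrix_list_mat)

lemma char_poly_list_mat_perm:
  fixes f :: "'a \<Rightarrow> 'a \<Rightarrow> 'b :: idom"
  assumes "distinct xs" "distinct ys" "set xs = set ys"
  shows "char_poly (list_mat f xs xs) = char_poly (list_mat f ys ys)"
  using assms det_list_mat_perm[of xs ys "char_entry f"]
  by (simp add: char_poly_list_mat set_eq_iff_mset_eq_distinct)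

lemma list_mat_append:
  "list_mat f (xs @ ys) (xs @ ys)
    = four_block_mat (list_mat f xs xs) (list_mat f xs ys) (list_mat f ys xs) (list_mat f ys ys)"
  by (rule eq_matI) (auto simp: nth_append)

lemma char_poly_list_mat_append:
  fixes f :: "'a \<Rightarrow> 'a \<Rightarrow> 'b :: idom"
  assumes "distinct (xs @ ys)" and zero: "\<And>x y. x \<in> set xs \<Longrightarrow> y \<in> set ys \<Longrightarrow> f y x = 0"
  shows "char_poly (list_mat f (xs @ ys) (xs @ ys))
    = char_poly (list_mat f xs xs) * char_poly (list_mat f ys ys)"
proof -
  have "list_mat (char_entry f) ys xs = 0\<^sub>m (length ys) (length xs)"
    using assms by (intro eq_matI) (auto simp: char_entry_def zero disjoint_iff, metis nth_mem)
  then show ?thesis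
    using assms(1)
    by (simp add: char_poly_list_mat[of "xs @ ys"] char_poly_list_mat[of xs] char_poly_list_mat[of ys]
        list_mat_append[of "char_entry f"] det_four_block_mat_lower_left_zero[OF list_mat_carrier list_mat_carrier])
qed

lemma sum_const_poly: "(\<Sum>x\<in>A. [:f x:]) = [:\<Sum>x\<in>A. f x:]"
  by (induction A rule: infinite_finite_induct) auto

lemma char_poly_bipartite:
  fixes f :: "'a \<Rightarrow> 'a \<Rightarrow> 'b :: idom"
  assumes dist: "distinct (xs @ ys)" and len: "length xs = length ys"
    and zx: "\<And>u v. u \<in> set xs \<Longrightarrow> v \<in> set xs \<Longrightarrow> f u v = 0"
    and zy: "\<And>u v. u \<in> set ys \<Longrightarrow> v \<in> set ys \<Longrightarrow> f u v = 0"
    and sym: "\<And>u v. f u v = f v u"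
  shows "char_poly (list_mat f (xs @ ys) (xs @ ys))
    = char_poly (list_mat f xs ys * transpose_mat (list_mat f xs ys)) \<circ>\<^sub>p monom 1 2"
proof -
  let ?n = "length xs" and ?X = "[:0, 1:] :: 'b poly"
  let ?c = "char_entry f"
  define g where "g u v = (\<Sum>y\<in>set ys. f u y * f v y)" for u v
  have dx: "distinct xs" and dy: "distinct ys" and disj: "set xs \<inter> set ys = {}"
    using dist by simp_all
  have diag: "list_mat ?c xs xs = ?X \<cdot>\<^sub>m 1\<^sub>m ?n" "list_mat ?c ys ys = ?X \<cdot>\<^sub>m 1\<^sub>m ?n"
    using dx dy by (auto intro!: eq_matI simp: char_entry_def zx zy nth_eq_iff_index_eq len)
  let ?B = "list_mat (\<lambda>u v. [:- f u v:]) xs ys"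
  have off: "list_mat ?c xs ys = ?B" "list_mat ?c ys xs = transpose_mat ?B"
    using disj by (auto intro!: eq_matI simp: char_entry_def sym disjoint_iff dest!: nth_mem)
  have B: "?B \<in> carrier_mat ?n ?n" "transpose_mat ?B \<in> carrier_mat ?n ?n"
    using list_mat_carrier[of "\<lambda>u v. [:- f u v:]" xs ys] len by simp_all
  have BB: "?B * transpose_mat ?B = list_mat (\<lambda>u v. [:g u v:]) xs xs"
    by (simp add: list_mat_mult_transpose[OF dy] g_def mult.commute sum_const_poly)
  have "char_poly (list_mat f (xs @ ys) (xs @ ys))
      = det (four_block_mat (?X \<cdot>\<^sub>m 1\<^sub>m ?n) ?B (transpose_mat ?B) (?X \<cdot>\<^sub>m 1\<^sub>m ?n))"
    using dist by (simp add: char_poly_list_mat list_mat_append[of ?c] diag off)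
  \<comment> \<open>The lower blocks commute because one of them is a scalar matrix. All four blocks
    must be square of one size, which is where \<open>len\<close> enters.\<close>
  also have "\<dots> = det ((?X \<cdot>\<^sub>m 1\<^sub>m ?n) * (?X \<cdot>\<^sub>m 1\<^sub>m ?n) - ?B * transpose_mat ?B)"
    by (rule det_four_block_mat) (use B in \<open>auto simp: len\<close>)
  \<comment> \<open>The result is the characteristic matrix of \<open>g\<close> with X^2 substituted
    for X; substitution is a ring homomorphism and so commutes with the determinant.\<close>
  also have "(?X \<cdot>\<^sub>m 1\<^sub>m ?n) * (?X \<cdot>\<^sub>m 1\<^sub>m ?n) - ?B * transpose_mat ?B
      = map_mat (\<lambda>p. p \<circ>\<^sub>p monom 1 2) (list_mat (char_entry g) xs xs)"
    using dx unfolding BB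
    by (intro eq_matI)
      (auto simp: char_entry_def nth_eq_iff_index_eq pcompose_pCons monom_altdef power2_eq_square)
  also have "det \<dots> = char_poly (list_mat g xs xs) \<circ>\<^sub>p monom 1 2"
    using dx by (simp add: char_poly_list_mat comm_ring_hom.hom_det[OF pcompose_hom.comm_ring_hom_axioms])
  finally show ?thesis
    by (simp add: list_mat_mult_transpose[OF dy] g_def[abs_def])
qed

section \<open>Continuants\<close>

text \<open>Euler's continuants in the signed variant that belongs to continued fractions with minus
  signs.\<close>

fun continuant :: "'a :: comm_ring_1 list \<Rightarrow> 'a" where
  "continuant [] = 1"
| "continuant [c] = c"
| "continuant (c # d # cs) = c * continuant (d # cs) - continuant cs"

text \<open>Only the product of mirror entries is fixed, since the entries themselves are 1 or -1
  depending on the weighting.\<close>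

fun unit_tridiagonal :: "('a \<Rightarrow> 'a \<Rightarrow> 'b :: comm_ring_1) \<Rightarrow> 'a list \<Rightarrow> bool" where
  "unit_tridiagonal f [] \<longleftrightarrow> True"
| "unit_tridiagonal f [x] \<longleftrightarrow> True"
| "unit_tridiagonal f (x # y # zs) \<longleftrightarrow> f x y * f y x = 1
     \<and> (\<forall>z\<in>set zs. f x z = 0 \<and> f z x = 0) \<and> unit_tridiagonal f (y # zs)"

text \<open>Expanding along the first row, and the minor of its second entry along the first column,
  gives the three-term recurrence; the off-diagonal entries survive only as the product
  \<open>f x y * f y x\<close>.\<close>

lemma det_unit_tridiagonal:
  fixes f :: "'a \<Rightarrow> 'a \<Rightarrow> 'b :: comm_ring_1"
  shows "unit_tridiagonal f xs \<Longrightarrow> det (list_mat f xs xs) = continuant (map (\<lambda>x. f x x) xs)"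
proof (induction xs rule: induct_list012)
  case 1
  then show ?case by (simp add: det_def)
next
  case (2 x)
  have "det (list_mat f [x] [x]) = list_mat f [x] [x] $$ (0, 0)"
    using list_mat_carrier[of f "[x]" "[x]"] by (intro det_single) simp
  then show ?case by simp
next
  case (3 x y zs)
  let ?n = "length zs" and ?A = "list_mat f (x # y # zs) (x # y # zs)"
  have row: "?A $$ (0, Suc (Suc j)) = 0" if "j < ?n" for j
    using 3 that by simp
  have col: "?A $$ (Suc (Suc j), 0) = 0" if "j < ?n" for j
    using 3 that by simp
  have carr: "?A \<in> carrier_mat (Suc (Suc ?n)) (Suc (Suc ?n))"
    using list_mat_carrier[of f "x # y # zs" "x # y # zs"] by simp
  have del0: "mat_delete ?A 0 0 = list_mat f (y # zs) (y # zs)"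
    by (rule eq_matI) (auto simp: mat_delete_def)
  let ?C = "mat_delete ?A 0 1"
  have C: "?C \<in> carrier_mat (Suc ?n) (Suc ?n)"
    using mat_delete_carrier[OF carr, of 0 1] by simp
  have del1: "mat_delete ?C 0 0 = list_mat f zs zs"
    by (rule eq_matI) (auto simp: mat_delete_def)
  have Cent: "?C $$ (0, 0) = f y x" "\<And>j. j < ?n \<Longrightarrow> ?C $$ (Suc j, 0) = 0"
    using col by (auto simp: mat_delete_def)
  have "det ?C = (\<Sum>i<Suc ?n. ?C $$ (i, 0) * cofactor ?C i 0)"
    by (rule laplace_expansion_column[OF C]) simp
  also have "\<dots> = f y x * det (list_mat f zs zs)"
    unfolding sum.lessThan_Suc_shift by (simp add: Cent cofactor_def del1 del: One_nat_def)
  finally have detC: "det ?C = f y x * det (list_mat f zs zs)" .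
  have "det ?A = (\<Sum>j<Suc (Suc ?n). ?A $$ (0, j) * cofactor ?A 0 j)"
    by (rule laplace_expansion_row[OF carr]) simp
  also have "\<dots> = f x x * det (list_mat f (y # zs) (y # zs)) - f x y * (f y x * det (list_mat f zs zs))"
    unfolding sum.lessThan_Suc_shift using row detC by (simp add: cofactor_def del0)
  also have "\<dots> = f x x * det (list_mat f (y # zs) (y # zs)) - (f x y * f y x) * det (list_mat f zs zs)"
    by (simp add: mult.assoc)
  finally have "det ?A = f x x * det (list_mat f (y # zs) (y # zs)) - (f x y * f y x) * det (list_mat f zs zs)" .
  moreover have "unit_tridiagonal f (y # zs)" "f x y * f y x = 1"
    using 3 by simp_all
  moreover have "det (list_mat f zs zs) = continuant (map (\<lambda>x. f x x) zs)"
  proof (cases zs)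
    case (Cons z zs')
    then show ?thesis using "3.IH"(1) \<open>unit_tridiagonal f (y # zs)\<close> by simp
  qed (simp add: det_def)
  ultimately show ?case
    using "3.IH" by simp
qed

text \<open>The subtracted continuant has degree two less than the product, so it cannot touch the
  leading term.\<close>

lemma monic_continuant:
  fixes cs :: "'a :: idom poly list"
  assumes "set cs \<subseteq> range (\<lambda>a. [:a, 1:])"
  shows "degree (continuant cs) = length cs \<and> lead_coeff (continuant cs) = 1"
  using assms
proof (induction cs rule: continuant.induct)
  case (3 c d cs)
  let ?p = "c * continuant (d # cs)" and ?q = "continuant cs"
  have c: "degree c = 1" "lead_coeff c = 1" using 3 by auto
  have d: "degree (continuant (d # cs)) = Suc (length cs)" "lead_coeff (continuant (d # cs)) = 1"
    using 3 by auto
  have q: "degree ?q = length cs" using 3 by auto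
  have "c \<noteq> 0" "continuant (d # cs) \<noteq> 0" using c d by force+
  then have p: "degree ?p = Suc (Suc (length cs))"
    using c d by (simp add: degree_mult_eq)
  have "lead_coeff ?p = 1" using c(2) d(2) by (metis lead_coeff_mult mult_1)
  moreover have "degree (?p + - ?q) = degree ?p"
    by (rule degree_add_eq_left) (simp add: p q)
  moreover have "lead_coeff (?p + - ?q) = lead_coeff ?p"
    using lead_coeff_add_le[of "- ?q" ?p] by (simp add: p q add.commute)
  ultimately show ?case using p by simp
qed auto

text \<open>The recurrence is a step of Euclid's algorithm: a common divisor passes down to the next
  shorter pair and finally to \<open>continuant [] = 1\<close>.\<close>

lemma coprime_continuant:
  fixes c :: "'a :: {comm_ring_1, algebraic_semidom}"
  shows "coprime (continuant (c # cs)) (continuant cs)"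
proof (induction cs arbitrary: c)
  case (Cons d cs)
  show ?case
  proof (rule coprimeI)
    fix e
    assume e: "e dvd continuant (c # d # cs)" "e dvd continuant (d # cs)"
    then have "e dvd c * continuant (d # cs) - continuant (c # d # cs)"
      by (intro dvd_diff dvd_mult)
    then have "e dvd continuant cs" by simp
    with e(2) Cons.IH[of d] show "is_unit e" by (meson coprime_common_divisor)
  qed
qed simp

lemma neg_cfrac_continuant:
  fixes cs :: "rat poly list"
  assumes "set (c # cs) \<subseteq> range (\<lambda>a. [:a, 1:])"
  shows "neg_cfrac (map to_fract (c # cs)) = Fract (continuant (c # cs)) (continuant cs)"
  using assms
proof (induction cs arbitrary: c)
  case Nil
  then show ?case by (simp add: to_fract_def)
next
  case (Cons d cs)
  \<comment> \<open>Division by zero yields 0, so inverting the tail of the fraction is only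
    meaningful with nonzero continuants; being monic they qualify.\<close>
  have "continuant (d # cs) \<noteq> 0" "continuant cs \<noteq> 0"
    using monic_continuant[of "d # cs"] monic_continuant[of cs] Cons.prems by force+
  then show ?case
    using Cons.IH[of d] Cons.prems by (simp add: to_fract_def divide_inverse mult.commute)
qed

lemma lowest_terms_continuant:
  fixes cs :: "rat poly list"
  assumes "cs \<noteq> []" "set cs \<subseteq> range (\<lambda>a. [:a, 1:])"
  shows "lowest_terms (neg_cfrac (map to_fract cs)) (continuant cs) (continuant (tl cs))"
proof -
  obtain c cs' where cs: "cs = c # cs'" using assms(1) by (cases cs) auto
  have "continuant cs' \<noteq> 0" "lead_coeff (continuant cs) = 1"
    using monic_continuant[of cs'] monic_continuant[of cs] assms(2) cs by force+
  then show ?thesis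
    using neg_cfrac_continuant[OF assms(2)[unfolded cs]] coprime_continuant[of c cs']
    unfolding lowest_terms_def cs list.sel by metis
qed

section \<open>Local structure of snake graphs\<close>

lemmas corner_defs = lower_left_def lower_right_def upper_left_def upper_right_def

text \<open>For one tile, \<open>start_edge\<close> and \<open>end_edge\<close> are not edges, so that case is separate.\<close>

definition rails :: "(int \<times> int) list \<Rightarrow> edge set" where
  "rails T = (if length T = 1
    then {{upper_left (hd T), upper_right (hd T)}, {lower_left (hd T), lower_right (hd T)}}
    else outer_edges T - {start_edge T, end_edge T})"

section \<open>Edges, vertices and degrees read off from the squares around a lattice point\<close>

lemma horizontal_edge_in_tile:
  "{(a, b), (a + 1, b)} \<in> tile_edges t \<longleftrightarrow> t = (a, b) \<or> t = (a, b - 1)"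
proof (cases t)
  case (Pair x y)
  then show ?thesis
    by (cases "a = x"; cases "b = y"; cases "b = y + 1")
      (simp_all add: tile_edges_def corner_defs doubleton_eq_iff)
qed

lemma vertical_edge_in_tile:
  "{(a, b), (a, b + 1)} \<in> tile_edges t \<longleftrightarrow> t = (a, b) \<or> t = (a - 1, b)"
proof (cases t)
  case (Pair x y)
  then show ?thesis
    by (cases "a = x"; cases "a = x + 1"; cases "b = y")
      (simp_all add: tile_edges_def corner_defs doubleton_eq_iff)
qed

lemma horizontal_edge: "{(a, b), (a + 1, b)} \<in> edges T \<longleftrightarrow> (a, b) \<in> set T \<or> (a, b - 1) \<in> set T"
  by (auto simp: edges_def horizontal_edge_in_tile)

lemma vertical_edge: "{(a, b), (a, b + 1)} \<in> edges T \<longleftrightarrow> (a, b) \<in> set T \<or> (a - 1, b) \<in> set T"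
  by (auto simp: edges_def vertical_edge_in_tile)

lemma edge_cases:
  assumes "{(a, b), v} \<in> edges T"
  shows "v \<in> {(a + 1, b), (a - 1, b), (a, b + 1), (a, b - 1)}"
  using assms by (auto simp: edges_def tile_edges_def corner_defs doubleton_eq_iff)

lemma edge_right: "{(a, b), (a + 1, b)} \<in> edges T \<longleftrightarrow> (a, b) \<in> set T \<or> (a, b - 1) \<in> set T"
  and edge_left: "{(a, b), (a - 1, b)} \<in> edges T \<longleftrightarrow> (a - 1, b) \<in> set T \<or> (a - 1, b - 1) \<in> set T"
  and edge_up: "{(a, b), (a, b + 1)} \<in> edges T \<longleftrightarrow> (a, b) \<in> set T \<or> (a - 1, b) \<in> set T"
  and edge_down: "{(a, b), (a, b - 1)} \<in> edges T \<longleftrightarrow> (a, b - 1) \<in> set T \<or> (a - 1, b - 1) \<in> set T"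
  using horizontal_edge[of a b T] horizontal_edge[of "a - 1" b T]
    vertical_edge[of a b T] vertical_edge[of a "b - 1" T]
  by (simp_all add: insert_commute)

lemma edges_subset_verts: "e \<in> edges T \<Longrightarrow> e \<subseteq> verts T"
  by (fastforce simp: edges_def verts_def tile_edges_def tile_vertices_def)

lemma tile_vertices_iff:
  "(x, y) \<in> tile_vertices (c, d) \<longleftrightarrow> (c = x \<or> c = x - 1) \<and> (d = y \<or> d = y - 1)"
  by (simp add: tile_vertices_def corner_defs, smt (verit))

lemma verts_iff:
  "(a, b) \<in> verts T \<longleftrightarrow>
    (a, b) \<in> set T \<or> (a - 1, b) \<in> set T \<or> (a - 1, b - 1) \<in> set T \<or> (a, b - 1) \<in> set T"
proof -
  have "(a, b) \<in> tile_vertices t \<longleftrightarrow> t \<in> {(a, b), (a - 1, b), (a - 1, b - 1), (a, b - 1)}" for t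
    by (cases t) (auto simp: tile_vertices_iff)
  then show ?thesis by (auto simp: verts_def)
qed

lemma finite_verts: "finite (verts T)"
  by (simp add: verts_def tile_vertices_def)

text \<open>Each direction contributes a neighbour when one of the two squares along that segment is
  a tile; degrees thus become computable from the four squares at the vertex.\<close>

lemma num_neighbours_eq:
  "num_neighbours T (a, b) =
    card ((if (a, b) \<in> set T \<or> (a, b - 1) \<in> set T then {(a + 1, b)} else {}) \<union>
      (if (a - 1, b) \<in> set T \<or> (a - 1, b - 1) \<in> set T then {(a - 1, b)} else {}) \<union>
      (if (a, b) \<in> set T \<or> (a - 1, b) \<in> set T then {(a, b + 1)} else {}) \<union>
      (if (a, b - 1) \<in> set T \<or> (a - 1, b - 1) \<in> set T then {(a, b - 1)} else {}))"
  (is "_ = card ?N")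
proof -
  have "{u \<in> verts T. {u, (a, b)} \<in> edges T} = {u. {(a, b), u} \<in> edges T}"
    using edges_subset_verts by (auto simp: insert_commute)
  also have "\<dots> = ?N"
  proof (rule Set.set_eqI)
    fix u
    show "u \<in> {u. {(a, b), u} \<in> edges T} \<longleftrightarrow> u \<in> ?N"
      using edge_cases[of a b u T] edge_right[of a b T] edge_left[of a b T]
        edge_up[of a b T] edge_down[of a b T]
      by auto
  qed
  finally show ?thesis by (simp add: num_neighbours_def)
qed

section \<open>The order of the tiles along antidiagonals\<close>

locale snake_graph =
  fixes T :: "(int \<times> int) list"
  assumes snake: "snake T"
begin

lemma nonempty: "T \<noteq> []"
  using snake by (simp add: snake_def)

lemma step: "Suc i < length T \<Longrightarrow> T ! Suc i = right_of (T ! i) \<or> T ! Suc i = above (T ! i)"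
  using snake by (simp add: snake_def)

text \<open>A step to the right and a step up both raise the coordinate sum by 1, so this sum, the
  level, determines the position in the list.\<close>

lemma level_nth:
  "i < length T \<Longrightarrow> fst (T ! i) + snd (T ! i) = fst (T ! 0) + snd (T ! 0) + int i"
  by (induction i) (use step in \<open>fastforce simp: right_of_def above_def\<close>)+

lemma tiles_same_level:
  assumes "(a, b) \<in> set T" "(c, d) \<in> set T" "a + b = c + d"
  shows "a = c" "b = d"
proof -
  obtain i j where ij: "i < length T" "T ! i = (a, b)" "j < length T" "T ! j = (c, d)"
    using assms by (metis in_set_conv_nth)
  then have "int i = int j" using level_nth[of i] level_nth[of j] assms(3) by simp
  then have "(a, b) = (c, d)" using ij by simp
  then show "a = c" "b = d" by simp_all
qed

text \<open>The tile \<open>(c, d)\<close> serves as a witness that \<open>(a, b)\<close> is not the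
  last one.\<close>

lemma succ_tile:
  assumes "(a, b) \<in> set T" "(c, d) \<in> set T" "a + b < c + d"
  shows "(a + 1, b) \<in> set T \<or> (a, b + 1) \<in> set T"
proof -
  obtain i j where ij: "i < length T" "T ! i = (a, b)" "j < length T" "T ! j = (c, d)"
    using assms by (metis in_set_conv_nth)
  then have "int i < int j" using level_nth[of i] level_nth[of j] assms(3) by simp
  then have "Suc i < length T" using ij by simp
  then have "T ! Suc i \<in> set T" by simp
  then show ?thesis using step[OF \<open>Suc i < length T\<close>] ij(2) by (auto simp: right_of_def above_def)
qed

lemma pred_tile:
  assumes "(a, b) \<in> set T" "(c, d) \<in> set T" "c + d < a + b"
  shows "(a - 1, b) \<in> set T \<or> (a, b - 1) \<in> set T"
proof -
  obtain i j where ij: "i < length T" "T ! i = (a, b)" "j < length T" "T ! j = (c, d)"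
    using assms by (metis in_set_conv_nth)
  then have "int j < int i" using level_nth[of i] level_nth[of j] assms(3) by simp
  then obtain k where k: "i = Suc k" by (cases i) auto
  then have "T ! k \<in> set T" using ij by simp
  moreover have "T ! k = (a - 1, b) \<or> T ! k = (a, b - 1)"
    using step[of k] ij k by (cases "T ! k") (auto simp: right_of_def above_def)
  ultimately show ?thesis by metis
qed

lemma tiles_mono:
  assumes "(a, b) \<in> set T" "(c, d) \<in> set T" "a + b \<le> c + d"
  shows "a \<le> c \<and> b \<le> d"
proof -
  obtain i j where ij: "i < length T" "T ! i = (a, b)" "j < length T" "T ! j = (c, d)"
    using assms by (metis in_set_conv_nth)
  then have "i \<le> j" using level_nth[of i] level_nth[of j] assms(3) by simp
  have "fst (T ! i) \<le> fst (T ! j) \<and> snd (T ! i) \<le> snd (T ! j)"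
    using \<open>i \<le> j\<close> ij(3)
  proof (induction j rule: dec_induct)
    case (step k)
    then show ?case using snake_graph.step[OF snake_graph_axioms, of k]
      by (auto simp: right_of_def above_def)
  qed simp
  then show ?thesis using ij by simp
qed

lemma hd_in: "hd T \<in> set T" and last_in: "last T \<in> set T"
  using nonempty by simp_all

lemma hd_level: "(a, b) \<in> set T \<Longrightarrow> fst (hd T) + snd (hd T) \<le> a + b"
proof -
  assume "(a, b) \<in> set T"
  then obtain i where "i < length T" "T ! i = (a, b)" by (metis in_set_conv_nth)
  then show ?thesis
    using level_nth[of i] nonempty by (simp add: hd_conv_nth)
qed

lemma last_level: "(a, b) \<in> set T \<Longrightarrow> a + b \<le> fst (last T) + snd (last T)"
proof -
  assume "(a, b) \<in> set T"
  then obtain i where "i < length T" "T ! i = (a, b)" by (metis in_set_conv_nth)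
  then show ?thesis
    using level_nth[of i] level_nth[of "length T - 1"] nonempty by (simp add: last_conv_nth)
qed

lemma length_one_iff: "length T = 1 \<longleftrightarrow> hd T = last T"
proof
  assume "hd T = last T"
  then show "length T = 1"
    using level_nth[of "length T - 1"] nonempty
    by (cases "length T") (auto simp: last_conv_nth hd_conv_nth)
qed (auto simp: length_Suc_conv)

lemma single_tile: "length T = 1 \<Longrightarrow> t \<in> set T \<Longrightarrow> t' \<in> set T \<Longrightarrow> t = t'"
  by (auto simp: length_Suc_conv)

lemma adjacent_tile:
  assumes "length T \<noteq> 1" "(a, b) \<in> set T"
  shows "(a + 1, b) \<in> set T \<or> (a, b + 1) \<in> set T \<or> (a - 1, b) \<in> set T \<or> (a, b - 1) \<in> set T"
proof -
  obtain c d where h: "hd T = (c, d)" by fastforce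
  obtain e f where l: "last T = (e, f)" by fastforce
  have "(c, d) \<noteq> (e, f)" "(c, d) \<in> set T" "(e, f) \<in> set T"
    using assms(1) length_one_iff h l hd_in last_in by auto
  \<comment> \<open>First and last tile have different levels, so at least one of them differs in
    level from \<open>(a, b)\<close> and forces a successor or a predecessor of it.\<close>
  then have "c + d \<noteq> e + f" using tiles_same_level by blast
  then have "c + d \<noteq> a + b \<or> e + f \<noteq> a + b" by linarith
  then show ?thesis
    using succ_tile[OF assms(2)] pred_tile[OF assms(2)] \<open>(c, d) \<in> set T\<close> \<open>(e, f) \<in> set T\<close>
    unfolding linorder_neq_iff by blast
qed

section \<open>Start and end edge in coordinates\<close>

lemma start_edge_eqI:
  assumes "hd T = (a, b)" "n \<in> set T" "n \<noteq> (a, b)"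
    and "e \<subseteq> tile_vertices (a, b)" "tile_vertices (a, b) \<subseteq> e \<union> tile_vertices n"
    and "\<And>t v. t \<in> set T \<Longrightarrow> t \<noteq> (a, b) \<Longrightarrow> v \<in> e \<Longrightarrow> v \<notin> tile_vertices t"
  shows "start_edge T = e"
  unfolding start_edge_def assms(1) using assms(2-) by blast

lemma start_edge_eq:
  assumes h: "hd T = (a, b)"
  shows "(a + 1, b) \<in> set T \<Longrightarrow> start_edge T = {(a, b), (a, b + 1)}"
    and "(a, b + 1) \<in> set T \<Longrightarrow> start_edge T = {(a, b), (a + 1, b)}"
proof -
  have other: "a + b < c + d" if "(c, d) \<in> set T" "(c, d) \<noteq> (a, b)" for c d
  proof -
    have "c + d \<noteq> a + b" using tiles_same_level[OF that(1), of a b] hd_in h that(2) by metis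
    then show ?thesis using hd_level[OF that(1)] h by simp
  qed
  \<comment> \<open>Here \<open>(a', b')\<close> is the second tile. All tiles but the first lie
    weakly above and to the right of it, and therefore miss the two vertices claimed for the start
    edge.\<close>
  have mono: "a' \<le> fst t \<and> b' \<le> snd t"
    if "t \<in> set T" "t \<noteq> (a, b)" "(a', b') \<in> set T" "a' + b' = a + b + 1" for a' b' t
    using other[of "fst t" "snd t"] tiles_mono[OF that(3), of "fst t" "snd t"] that by simp
  show "start_edge T = {(a, b), (a, b + 1)}" if n: "(a + 1, b) \<in> set T"
  proof (rule start_edge_eqI[OF h n])
    fix t v
    assume t: "t \<in> set T" "t \<noteq> (a, b)" and v: "v \<in> {(a, b), (a, b + 1)}"
    have "a + 1 \<le> fst t" using mono[OF t n] by simp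
    with v show "v \<notin> tile_vertices t" by (cases t) (auto simp: tile_vertices_iff)
  qed (auto simp: tile_vertices_def corner_defs)
  show "start_edge T = {(a, b), (a + 1, b)}" if n: "(a, b + 1) \<in> set T"
  proof (rule start_edge_eqI[OF h n])
    fix t v
    assume t: "t \<in> set T" "t \<noteq> (a, b)" and v: "v \<in> {(a, b), (a + 1, b)}"
    have "b + 1 \<le> snd t" using mono[OF t n] by simp
    with v show "v \<notin> tile_vertices t" by (cases t) (auto simp: tile_vertices_iff)
  qed (auto simp: tile_vertices_def corner_defs)
qed

lemma end_edge_eqI:
  assumes "last T = (a, b)" "n \<in> set T" "n \<noteq> (a, b)"
    and "e \<subseteq> tile_vertices (a, b)" "tile_vertices (a, b) \<subseteq> e \<union> tile_vertices n"
    and "\<And>t v. t \<in> set T \<Longrightarrow> t \<noteq> (a, b) \<Longrightarrow> v \<in> e \<Longrightarrow> v \<notin> tile_vertices t"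
  shows "end_edge T = e"
  unfolding end_edge_def assms(1) using assms(2-) by blast

lemma end_edge_eq:
  assumes h: "last T = (a, b)"
  shows "(a - 1, b) \<in> set T \<Longrightarrow> end_edge T = {(a + 1, b), (a + 1, b + 1)}"
    and "(a, b - 1) \<in> set T \<Longrightarrow> end_edge T = {(a, b + 1), (a + 1, b + 1)}"
proof -
  have other: "c + d < a + b" if "(c, d) \<in> set T" "(c, d) \<noteq> (a, b)" for c d
  proof -
    have "c + d \<noteq> a + b" using tiles_same_level[OF that(1), of a b] last_in h that(2) by metis
    then show ?thesis using last_level[OF that(1)] h by simp
  qed
  have mono: "fst t \<le> a' \<and> snd t \<le> b'"
    if "t \<in> set T" "t \<noteq> (a, b)" "(a', b') \<in> set T" "a' + b' = a + b - 1" for a' b' t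
    using other[of "fst t" "snd t"] tiles_mono[of "fst t" "snd t", OF _ that(3)] that by simp
  show "end_edge T = {(a + 1, b), (a + 1, b + 1)}" if n: "(a - 1, b) \<in> set T"
  proof (rule end_edge_eqI[OF h n])
    fix t v
    assume t: "t \<in> set T" "t \<noteq> (a, b)" and v: "v \<in> {(a + 1, b), (a + 1, b + 1)}"
    have "fst t \<le> a - 1" using mono[OF t n] by simp
    with v show "v \<notin> tile_vertices t" by (cases t) (auto simp: tile_vertices_iff)
  qed (auto simp: tile_vertices_def corner_defs)
  show "end_edge T = {(a, b + 1), (a + 1, b + 1)}" if n: "(a, b - 1) \<in> set T"
  proof (rule end_edge_eqI[OF h n])
    fix t v
    assume t: "t \<in> set T" "t \<noteq> (a, b)" and v: "v \<in> {(a, b + 1), (a + 1, b + 1)}"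
    have "snd t \<le> b - 1" using mono[OF t n] by simp
    with v show "v \<notin> tile_vertices t" by (cases t) (auto simp: tile_vertices_iff)
  qed (auto simp: tile_vertices_def corner_defs)
qed

lemma exactly_one_of_two:
  "p \<noteq> q \<Longrightarrow> (\<exists>!t. t \<in> A \<and> (t = p \<or> t = q)) \<longleftrightarrow> (p \<in> A \<longleftrightarrow> q \<notin> A)"
  by metis

lemma outer_horizontal:
  "{(a, b), (a + 1, b)} \<in> outer_edges T \<longleftrightarrow> ((a, b) \<in> set T \<longleftrightarrow> (a, b - 1) \<notin> set T)"
proof -
  have "(a, b) \<noteq> (a, b - 1)" by simp
  then show ?thesis
    unfolding outer_edges_def mem_Collect_eq horizontal_edge horizontal_edge_in_tile
    by (subst exactly_one_of_two) blast+
qed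

lemma outer_vertical:
  "{(a, b), (a, b + 1)} \<in> outer_edges T \<longleftrightarrow> ((a, b) \<in> set T \<longleftrightarrow> (a - 1, b) \<notin> set T)"
proof -
  have "(a, b) \<noteq> (a - 1, b)" by simp
  then show ?thesis
    unfolding outer_edges_def mem_Collect_eq vertical_edge vertical_edge_in_tile
    by (subst exactly_one_of_two) blast+
qed

end

lemma unit_segment_eq_iff:
  fixes a b c d :: int
  shows "{(a, b), (a + 1, b)} = {(c, d), (c + 1, d)} \<longleftrightarrow> c = a \<and> d = b"
    and "{(a, b), (a, b + 1)} = {(c, d), (c, d + 1)} \<longleftrightarrow> c = a \<and> d = b"
    and "{(a, b), (a + 1, b)} \<noteq> {(c, d), (c, d + 1)}"
    and "{(a, b), (a, b + 1)} \<noteq> {(c, d), (c + 1, d)}"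
  by (simp_all add: doubleton_eq_iff) linarith+

section \<open>First tile, last tile and rails recognised from neighbouring squares\<close>

context snake_graph
begin

lemma not_both_antidiagonal: "(a, b) \<in> set T \<Longrightarrow> (a + 1, b - 1) \<in> set T \<Longrightarrow> False"
  using tiles_same_level[of a b "a + 1" "b - 1"] by simp

lemma not_both_succ: "(a + 1, b) \<in> set T \<Longrightarrow> (a, b + 1) \<in> set T \<Longrightarrow> False"
  using not_both_antidiagonal[of a "b + 1"] by simp

text \<open>A tile without predecessor has minimal level. Together with \<open>last_iff\<close> this
  trades list order for membership of squares, so that later claims about rails are settled by
  propositional reasoning.\<close>

lemma hd_iff:
  assumes "(a, b) \<in> set T"
  shows "hd T = (a, b) \<longleftrightarrow> (a - 1, b) \<notin> set T \<and> (a, b - 1) \<notin> set T"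
proof
  assume "hd T = (a, b)"
  then show "(a - 1, b) \<notin> set T \<and> (a, b - 1) \<notin> set T"
    using hd_level[of "a - 1" b] hd_level[of a "b - 1"] by auto
next
  assume no_pred: "(a - 1, b) \<notin> set T \<and> (a, b - 1) \<notin> set T"
  obtain c d where h: "hd T = (c, d)" by fastforce
  then have cd: "(c, d) \<in> set T" using hd_in by simp
  then have "\<not> c + d < a + b" using pred_tile[OF assms cd] no_pred by blast
  then have "a + b = c + d" using hd_level[OF assms] h by simp
  then show "hd T = (a, b)" using tiles_same_level[OF assms cd] h by simp
qed

lemma last_iff:
  assumes "(a, b) \<in> set T"
  shows "last T = (a, b) \<longleftrightarrow> (a + 1, b) \<notin> set T \<and> (a, b + 1) \<notin> set T"
proof
  assume "last T = (a, b)"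
  then show "(a + 1, b) \<notin> set T \<and> (a, b + 1) \<notin> set T"
    using last_level[of "a + 1" b] last_level[of a "b + 1"] by auto
next
  assume no_succ: "(a + 1, b) \<notin> set T \<and> (a, b + 1) \<notin> set T"
  obtain c d where h: "last T = (c, d)" by fastforce
  then have cd: "(c, d) \<in> set T" using last_in by simp
  then have "\<not> a + b < c + d" using succ_tile[OF assms cd] no_succ by blast
  then have "a + b = c + d" using last_level[OF assms] h by simp
  then show "last T = (a, b)" using tiles_same_level[OF assms cd] h by simp
qed

lemma start_edge_cases:
  assumes "length T \<noteq> 1" "hd T = (a, b)"
  obtains "(a + 1, b) \<in> set T" "(a, b + 1) \<notin> set T" "start_edge T = {(a, b), (a, b + 1)}"
    | "(a, b + 1) \<in> set T" "(a + 1, b) \<notin> set T" "start_edge T = {(a, b), (a + 1, b)}"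
proof -
  have "(a, b) \<in> set T" using assms(2) hd_in by simp
  then show thesis
    using adjacent_tile[OF assms(1)] hd_iff[of a b] assms(2) start_edge_eq[OF assms(2)]
      not_both_succ that
    by blast
qed

lemma end_edge_cases:
  assumes "length T \<noteq> 1" "last T = (a, b)"
  obtains "(a - 1, b) \<in> set T" "(a, b - 1) \<notin> set T" "end_edge T = {(a + 1, b), (a + 1, b + 1)}"
    | "(a, b - 1) \<in> set T" "(a - 1, b) \<notin> set T" "end_edge T = {(a, b + 1), (a + 1, b + 1)}"
proof -
  have "(a, b) \<in> set T" using assms(2) last_in by simp
  then show thesis
    using adjacent_tile[OF assms(1)] last_iff[of a b] assms(2) end_edge_eq[OF assms(2)]
      not_both_antidiagonal[of "a - 1" b, unfolded diff_add_cancel] that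
    by blast
qed

lemma start_edge_horizontal:
  assumes "length T \<noteq> 1"
  shows "{(a, b), (a + 1, b)} = start_edge T \<longleftrightarrow> hd T = (a, b) \<and> (a, b + 1) \<in> set T"
proof -
  obtain c d where h: "hd T = (c, d)" by fastforce
  from assms h show ?thesis
  proof (cases rule: start_edge_cases)
    case 1
    then show ?thesis using h by (auto simp: unit_segment_eq_iff)
  next
    case 2
    then show ?thesis using h by (auto simp: unit_segment_eq_iff)
  qed
qed

lemma start_edge_vertical:
  assumes "length T \<noteq> 1"
  shows "{(a, b), (a, b + 1)} = start_edge T \<longleftrightarrow> hd T = (a, b) \<and> (a + 1, b) \<in> set T"
proof -
  obtain c d where h: "hd T = (c, d)" by fastforce
  from assms h show ?thesis
  proof (cases rule: start_edge_cases)
    case 1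
    then show ?thesis using h by (auto simp: unit_segment_eq_iff)
  next
    case 2
    then show ?thesis using h by (auto simp: unit_segment_eq_iff)
  qed
qed

lemma end_edge_horizontal:
  assumes "length T \<noteq> 1"
  shows "{(a, b), (a + 1, b)} = end_edge T \<longleftrightarrow> last T = (a, b - 1) \<and> (a, b - 2) \<in> set T"
proof -
  obtain c d where h: "last T = (c, d)" by fastforce
  from assms h show ?thesis
  proof (cases rule: end_edge_cases)
    case 1
    then show ?thesis using h by (auto simp: unit_segment_eq_iff)
  next
    case 2
    then show ?thesis using h by (auto simp: unit_segment_eq_iff)
  qed
qed

lemma end_edge_vertical:
  assumes "length T \<noteq> 1"
  shows "{(a, b), (a, b + 1)} = end_edge T \<longleftrightarrow> last T = (a - 1, b) \<and> (a - 2, b) \<in> set T"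
proof -
  obtain c d where h: "last T = (c, d)" by fastforce
  from assms h show ?thesis
  proof (cases rule: end_edge_cases)
    case 1
    then show ?thesis using h by (auto simp: unit_segment_eq_iff)
  next
    case 2
    then show ?thesis using h by (auto simp: unit_segment_eq_iff)
  qed
qed

lemma hd_neq_last: "length T \<noteq> 1 \<Longrightarrow> hd T \<noteq> last T"
  using length_one_iff by blast

text \<open>Let an outer horizontal edge belong to a tile without horizontal neighbours. If there
  are several tiles, that tile must be the first or the last, with its only neighbour on the side
  opposite to the edge; the edge is then the start or the end edge. A horizontal neighbour excludes
  this.\<close>

lemma rail_horizontal:
  "{(a, b), (a + 1, b)} \<in> rails T \<longleftrightarrow>
    (a, b) \<in> set T \<and> (a, b - 1) \<notin> set T \<and> ((a - 1, b) \<in> set T \<or> (a + 1, b) \<in> set T \<or> length T = 1) \<or>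
    (a, b - 1) \<in> set T \<and> (a, b) \<notin> set T \<and> ((a - 1, b - 1) \<in> set T \<or> (a + 1, b - 1) \<in> set T \<or> length T = 1)"
proof (cases "length T = 1")
  case True
  then obtain x y where "T = [(x, y)]" by (auto simp: length_Suc_conv)
  then show ?thesis
    by (auto simp: rails_def corner_defs doubleton_eq_iff)
next
  case False
  have "{(a, b), (a + 1, b)} \<in> rails T \<longleftrightarrow> ((a, b) \<in> set T \<longleftrightarrow> (a, b - 1) \<notin> set T)
      \<and> \<not> (hd T = (a, b) \<and> (a, b + 1) \<in> set T) \<and> \<not> (last T = (a, b - 1) \<and> (a, b - 2) \<in> set T)"
    using False start_edge_horizontal[OF False, of a b] end_edge_horizontal[OF False, of a b]
    by (simp add: rails_def outer_horizontal)
  moreover have "hd T = (a, b) \<Longrightarrow> (a, b) \<in> set T" "last T = (a, b - 1) \<Longrightarrow> (a, b - 1) \<in> set T"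
    using hd_in last_in by metis+
  moreover have "hd T = (a, b) \<Longrightarrow> last T \<noteq> (a, b)" "hd T = (a, b - 1) \<Longrightarrow> last T \<noteq> (a, b - 1)"
    using hd_neq_last[OF False] by auto
  moreover have "(a, b - 1) \<in> set T \<longrightarrow>
      (hd T = (a, b - 1) \<longleftrightarrow> (a - 1, b - 1) \<notin> set T \<and> (a, b - 2) \<notin> set T)"
    "(a, b - 1) \<in> set T \<longrightarrow>
      (last T = (a, b - 1) \<longleftrightarrow> (a + 1, b - 1) \<notin> set T \<and> (a, b) \<notin> set T)"
    using hd_iff[of a "b - 1"] last_iff[of a "b - 1"] by simp_all
  ultimately show ?thesis
    using False hd_iff[of a b] last_iff[of a b] not_both_succ[of a b]
      not_both_antidiagonal[of "a - 1" "b - 1", simplified]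
    by argo
qed

text \<open>No disjunct for \<open>length T = 1\<close> appears here, because the rails of a single
  tile are its two horizontal edges.\<close>

lemma rail_vertical:
  "{(a, b), (a, b + 1)} \<in> rails T \<longleftrightarrow>
    (a, b) \<in> set T \<and> (a - 1, b) \<notin> set T \<and> ((a, b - 1) \<in> set T \<or> (a, b + 1) \<in> set T) \<or>
    (a - 1, b) \<in> set T \<and> (a, b) \<notin> set T \<and> ((a - 1, b - 1) \<in> set T \<or> (a - 1, b + 1) \<in> set T)"
proof (cases "length T = 1")
  case True
  then obtain x y where "T = [(x, y)]" by (auto simp: length_Suc_conv)
  then show ?thesis
    by (auto simp: rails_def corner_defs doubleton_eq_iff)
next
  case False
  have "{(a, b), (a, b + 1)} \<in> rails T \<longleftrightarrow> ((a, b) \<in> set T \<longleftrightarrow> (a - 1, b) \<notin> set T)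
      \<and> \<not> (hd T = (a, b) \<and> (a + 1, b) \<in> set T) \<and> \<not> (last T = (a - 1, b) \<and> (a - 2, b) \<in> set T)"
    using False start_edge_vertical[OF False, of a b] end_edge_vertical[OF False, of a b]
    by (simp add: rails_def outer_vertical)
  moreover have "hd T = (a, b) \<Longrightarrow> (a, b) \<in> set T" "last T = (a - 1, b) \<Longrightarrow> (a - 1, b) \<in> set T"
    using hd_in last_in by metis+
  moreover have "hd T = (a, b) \<Longrightarrow> last T \<noteq> (a, b)" "hd T = (a - 1, b) \<Longrightarrow> last T \<noteq> (a - 1, b)"
    using hd_neq_last[OF False] by auto
  moreover have "(a - 1, b) \<in> set T \<longrightarrow>
      (hd T = (a - 1, b) \<longleftrightarrow> (a - 2, b) \<notin> set T \<and> (a - 1, b - 1) \<notin> set T)"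
    "(a - 1, b) \<in> set T \<longrightarrow>
      (last T = (a - 1, b) \<longleftrightarrow> (a, b) \<notin> set T \<and> (a - 1, b + 1) \<notin> set T)"
    using hd_iff[of "a - 1" b] last_iff[of "a - 1" b] by simp_all
  ultimately show ?thesis
    using hd_iff[of a b] last_iff[of a b] not_both_succ[of a b]
      not_both_antidiagonal[of "a - 2" b, simplified]
    by argo
qed

lemma rail_right: "{(a, b), (a + 1, b)} \<in> rails T \<longleftrightarrow>
    (a, b) \<in> set T \<and> (a, b - 1) \<notin> set T \<and> ((a - 1, b) \<in> set T \<or> (a + 1, b) \<in> set T \<or> length T = 1) \<or>
    (a, b - 1) \<in> set T \<and> (a, b) \<notin> set T \<and> ((a - 1, b - 1) \<in> set T \<or> (a + 1, b - 1) \<in> set T \<or> length T = 1)"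
  and rail_left: "{(a, b), (a - 1, b)} \<in> rails T \<longleftrightarrow>
    (a - 1, b) \<in> set T \<and> (a - 1, b - 1) \<notin> set T \<and> ((a - 2, b) \<in> set T \<or> (a, b) \<in> set T \<or> length T = 1) \<or>
    (a - 1, b - 1) \<in> set T \<and> (a - 1, b) \<notin> set T \<and> ((a - 2, b - 1) \<in> set T \<or> (a, b - 1) \<in> set T \<or> length T = 1)"
  and rail_up: "{(a, b), (a, b + 1)} \<in> rails T \<longleftrightarrow>
    (a, b) \<in> set T \<and> (a - 1, b) \<notin> set T \<and> ((a, b - 1) \<in> set T \<or> (a, b + 1) \<in> set T) \<or>
    (a - 1, b) \<in> set T \<and> (a, b) \<notin> set T \<and> ((a - 1, b - 1) \<in> set T \<or> (a - 1, b + 1) \<in> set T)"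
  and rail_down: "{(a, b), (a, b - 1)} \<in> rails T \<longleftrightarrow>
    (a, b - 1) \<in> set T \<and> (a - 1, b - 1) \<notin> set T \<and> ((a, b - 2) \<in> set T \<or> (a, b) \<in> set T) \<or>
    (a - 1, b - 1) \<in> set T \<and> (a, b - 1) \<notin> set T \<and> ((a - 1, b - 2) \<in> set T \<or> (a - 1, b) \<in> set T)"
  using rail_horizontal[of a b] rail_horizontal[of "a - 1" b]
    rail_vertical[of a b] rail_vertical[of a "b - 1"]
  by (simp_all add: insert_commute)

lemma rails_subset_edges: "rails T \<subseteq> edges T"
proof (cases "length T = 1")
  case True
  then have "rails T \<subseteq> tile_edges (hd T)" by (simp add: rails_def tile_edges_def)
  then show ?thesis using hd_in by (auto simp: edges_def)
next
  case False
  then show ?thesis by (auto simp: rails_def outer_edges_def)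
qed

text \<open>Needed because the boundary paths are specified by edges: this is what makes them reach
  every vertex.\<close>

lemma vertex_in_rail:
  assumes "(a, b) \<in> verts T"
  shows "\<exists>v. {(a, b), v} \<in> rails T"
proof -
  note adj = adjacent_tile[of a b] adjacent_tile[of "a - 1" b, simplified]
    adjacent_tile[of a "b - 1", simplified] adjacent_tile[of "a - 1" "b - 1", simplified]
  have "(a - 1, b - 1) \<in> set T \<Longrightarrow> (a, b) \<in> set T \<Longrightarrow> (a - 1, b) \<in> set T \<or> (a, b - 1) \<in> set T"
    using succ_tile[of "a - 1" "b - 1" a b] by auto
  moreover have "\<not> ((a - 1, b) \<in> set T \<and> (a, b - 1) \<in> set T)"
    using not_both_antidiagonal[of "a - 1" b] by auto
  ultimately have "{(a, b), (a + 1, b)} \<in> rails T \<or> {(a, b), (a - 1, b)} \<in> rails T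
      \<or> {(a, b), (a, b + 1)} \<in> rails T \<or> {(a, b), (a, b - 1)} \<in> rails T"
    using assms adj unfolding rail_right rail_left rail_up rail_down verts_iff One_nat_def by argo
  then show ?thesis by blast
qed

text \<open>Near the first tile no other square of the same or a lower level is a tile, which leaves
  a single rail at each end of the start edge; likewise at the end edge. Such a vertex cannot be
  interior to a boundary path.\<close>

lemma start_end_degree:
  assumes "length T \<noteq> 1" "x \<in> start_edge T \<union> end_edge T" "{x, u} \<in> rails T" "{x, v} \<in> rails T"
  shows "u = v"
proof -
  obtain a b where x: "x = (a, b)" by fastforce
  \<comment> \<open>The premise on \<open>edges T\<close> follows from that on
    \<open>rails T\<close>; it is there so that \<open>edge_cases\<close> can reduce
    \<open>u\<close> to four candidates.\<close>
  have "\<exists>w. \<forall>u. {(a, b), u} \<in> edges T \<longrightarrow> {(a, b), u} \<in> rails T \<longrightarrow> u = w"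
  proof (cases "x \<in> start_edge T")
    case True
    obtain c d where h: "hd T = (c, d)" by fastforce
    have cd: "(c, d) \<in> set T" using h hd_in by simp
    have not_in: "(a', b') \<notin> set T" if "a' + b' \<le> c + d" "(a', b') \<noteq> (c, d)" for a' b'
      using hd_level[of a' b'] tiles_same_level[of a' b' c d] that h cd by fastforce
    from assms(1) h show ?thesis
    proof (cases rule: start_edge_cases)
      case 1
      then consider "a = c" "b = d" | "a = c" "b = d + 1" using True x by auto
      then show ?thesis
      proof cases
        case 1
        have "u = (c + 1, d)" if "{(a, b), u} \<in> edges T" "{(a, b), u} \<in> rails T" for u
          using edge_cases[OF that(1)] that(2) 1 not_in[of "c - 1" d] not_in[of c "d - 1"]
            not_in[of "c - 1" "d - 1"] \<open>(c, d + 1) \<notin> set T\<close> rail_left[of a b] rail_up[of a b] rail_down[of a b]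
          by auto
        then show ?thesis by blast
      next
        case 2
        have "u = (c + 1, d + 1)" if "{(a, b), u} \<in> edges T" "{(a, b), u} \<in> rails T" for u
          using edge_cases[OF that(1)] that(2) 2 not_in[of "c - 1" "d + 1"] not_in[of c "d - 1"]
            not_in[of "c - 1" d] \<open>(c, d + 1) \<notin> set T\<close> rail_left[of a b] rail_up[of a b] rail_down[of a b]
          by auto
        then show ?thesis by blast
      qed
    next
      case 2
      then consider "a = c" "b = d" | "a = c + 1" "b = d" using True x by auto
      then show ?thesis
      proof cases
        case 1
        have "u = (c, d + 1)" if "{(a, b), u} \<in> edges T" "{(a, b), u} \<in> rails T" for u
          using edge_cases[OF that(1)] that(2) 1 not_in[of "c - 1" d] not_in[of c "d - 1"]
            not_in[of "c - 1" "d - 1"] \<open>(c + 1, d) \<notin> set T\<close> assms(1) rail_left[of a b] rail_right[of a b] rail_down[of a b]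
          by auto
        then show ?thesis by blast
      next
        case 2
        have "u = (c + 1, d + 1)" if "{(a, b), u} \<in> edges T" "{(a, b), u} \<in> rails T" for u
          using edge_cases[OF that(1)] that(2) 2 not_in[of "c + 1" "d - 1"] not_in[of c "d - 1"]
            not_in[of "c - 1" d] \<open>(c + 1, d) \<notin> set T\<close> assms(1) rail_left[of a b] rail_right[of a b] rail_down[of a b]
          by auto
        then show ?thesis by blast
      qed
    qed
  next
    case False
    obtain c d where h: "last T = (c, d)" by fastforce
    have cd: "(c, d) \<in> set T" using h last_in by simp
    have not_in: "(a', b') \<notin> set T" if "c + d \<le> a' + b'" "(a', b') \<noteq> (c, d)" for a' b'
      using last_level[of a' b'] tiles_same_level[of a' b' c d] that h cd by fastforce
    have x_end: "x \<in> end_edge T" using False assms(2) by simp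
    from assms(1) h show ?thesis
    proof (cases rule: end_edge_cases)
      case 1
      then consider "a = c + 1" "b = d" | "a = c + 1" "b = d + 1" using x_end x by auto
      then show ?thesis
      proof cases
        case 1
        have "u = (c, d)" if "{(a, b), u} \<in> edges T" "{(a, b), u} \<in> rails T" for u
          using edge_cases[OF that(1)] that(2) 1 not_in[of "c + 1" d] not_in[of "c + 1" "d - 1"]
            not_in[of c "d + 1"] \<open>(c, d - 1) \<notin> set T\<close> rail_right[of a b] rail_up[of a b] rail_down[of a b]
          by auto
        then show ?thesis by blast
      next
        case 2
        have "u = (c, d + 1)" if "{(a, b), u} \<in> edges T" "{(a, b), u} \<in> rails T" for u
          using edge_cases[OF that(1)] that(2) 2 not_in[of "c + 1" "d + 1"] not_in[of c "d + 1"]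
            not_in[of "c + 1" d] \<open>(c, d - 1) \<notin> set T\<close> rail_right[of a b] rail_up[of a b] rail_down[of a b]
          by auto
        then show ?thesis by blast
      qed
    next
      case 2
      then consider "a = c" "b = d + 1" | "a = c + 1" "b = d + 1" using x_end x by auto
      then show ?thesis
      proof cases
        case 1
        have "u = (c, d)" if "{(a, b), u} \<in> edges T" "{(a, b), u} \<in> rails T" for u
          using edge_cases[OF that(1)] that(2) 1 not_in[of "c - 1" "d + 1"] not_in[of c "d + 1"]
            not_in[of "c + 1" d] \<open>(c - 1, d) \<notin> set T\<close> assms(1) rail_left[of a b] rail_right[of a b] rail_up[of a b]
          by auto
        then show ?thesis by blast
      next
        case 2
        have "u = (c + 1, d)" if "{(a, b), u} \<in> edges T" "{(a, b), u} \<in> rails T" for u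
          using edge_cases[OF that(1)] that(2) 2 not_in[of "c + 1" "d + 1"] not_in[of c "d + 1"]
            not_in[of "c + 1" d] \<open>(c - 1, d) \<notin> set T\<close> assms(1) rail_left[of a b] rail_right[of a b] rail_up[of a b]
          by auto
        then show ?thesis by blast
      qed
    qed
  qed
  then show ?thesis using assms(3,4) rails_subset_edges unfolding x by blast
qed

lemma card_start_end:
  assumes "length T \<noteq> 1"
  shows "card (start_edge T \<union> end_edge T) = 4" "start_edge T \<union> end_edge T \<subseteq> verts T"
proof -
  obtain a b where h: "hd T = (a, b)" by fastforce
  obtain c d where l: "last T = (c, d)" by fastforce
  have in_T: "(a, b) \<in> set T" "(c, d) \<in> set T" using h l hd_in last_in by metis+
  have "a + b \<noteq> c + d"
    using tiles_same_level[OF in_T] hd_neq_last[OF assms] h l by auto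
  then have less: "a + b < c + d" using hd_level[OF in_T(2)] h by simp
  \<comment> \<open>Coordinate sums separate the two edges: at most 1 above the level of the first
    tile, at least 1 above that of the last.\<close>
  have s: "card (start_edge T) = 2 \<and> finite (start_edge T) \<and>
      (\<forall>v\<in>start_edge T. fst v + snd v \<le> a + b + 1)"
    using assms h by (cases rule: start_edge_cases) simp_all
  moreover have e: "card (end_edge T) = 2 \<and> finite (end_edge T) \<and>
      (\<forall>v\<in>end_edge T. c + d + 1 \<le> fst v + snd v)"
    using assms l by (cases rule: end_edge_cases) simp_all
  moreover have "start_edge T \<inter> end_edge T = {}"
    using s e less by fastforce
  ultimately show "card (start_edge T \<union> end_edge T) = 4" by (simp add: card_Un_disjoint)
  show "start_edge T \<union> end_edge T \<subseteq> verts T"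
    using hd_in last_in by (auto simp: start_edge_def end_edge_def verts_def)
qed

end

section \<open>The Gram matrix of the black vertices\<close>

lemma corner_eq_iff:
  "(a, b) = lower_left t \<longleftrightarrow> t = (a, b)"
  "(a, b) = lower_right t \<longleftrightarrow> t = (a - 1, b)"
  "(a, b) = upper_left t \<longleftrightarrow> t = (a, b - 1)"
  "(a, b) = upper_right t \<longleftrightarrow> t = (a - 1, b - 1)"
  by (cases t; auto simp: corner_defs)+

section \<open>Tiles and rails at a white vertex\<close>

locale coloured_snake = snake_graph +
  fixes black :: "vertex \<Rightarrow> bool"
  assumes proper: "proper_colouring T black"
    and turns_black: "is_turn T v \<Longrightarrow> black v"
begin

lemma edge_colours: "{u, v} \<in> edges T \<Longrightarrow> black u \<longleftrightarrow> \<not> black v"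
  using proper edges_subset_verts[of "{u, v}" T] by (auto simp: proper_colouring_def)

text \<open>Between two diagonally adjacent tiles lies a third, so the vertex would have degree 4.
  Comparing levels shows that it is none of the exempted corners, hence a turn.\<close>

lemma white_not_inner_corner:
  assumes "\<not> black (a, b)" "(a, b) \<in> set T" "(a - 1, b - 1) \<in> set T"
  shows False
proof -
  obtain c d where h: "hd T = (c, d)" by fastforce
  obtain e f where l: "last T = (e, f)" by fastforce
  have le: "c + d \<le> (a - 1) + (b - 1)" "a + b \<le> e + f"
    using hd_level[OF assms(3)] last_level[OF assms(2)] h l by simp_all
  have "(a - 1, b) \<in> set T \<or> (a, b - 1) \<in> set T"
    using pred_tile[OF assms(2,3)] by simp
  with assms have "num_neighbours T (a, b) = 4" by (auto simp: num_neighbours_eq)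
  then have "is_turn T (a, b)"
    using le assms(2) by (auto simp: is_turn_def verts_iff h l corner_defs)
  then show False using turns_black assms(1) by blast
qed

text \<open>The vertex is a corner of the single tile \<open>(a, b - 1)\<close> and has degree 2, so
  only the exemption for the first and last tile can keep it from being a turn.\<close>

lemma white_outer_corner_upper:
  assumes "\<not> black (a, b)" "(a, b - 1) \<in> set T"
    and "(a, b) \<notin> set T" "(a - 1, b - 1) \<notin> set T"
  shows "hd T = (a, b - 1) \<or> last T = (a, b - 1)"
proof (rule ccontr)
  assume neq: "\<not> ?thesis"
  have "(a - 1, b) \<notin> set T" using not_both_antidiagonal[of "a - 1" b] assms(2) by auto
  then have "num_neighbours T (a, b) = 2" using assms by (auto simp: num_neighbours_eq)
  moreover have "hd T \<noteq> (a, b)" "hd T \<noteq> (a - 1, b)" "last T \<noteq> (a - 1, b - 1)" "last T \<noteq> (a - 1, b)"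
    using hd_in last_in assms \<open>(a - 1, b) \<notin> set T\<close> by metis+
  ultimately have "is_turn T (a, b)"
    using neq assms(2) by (simp add: is_turn_def verts_iff corner_eq_iff)
  then show False using turns_black assms(1) by blast
qed

lemma white_outer_corner_lower:
  assumes "\<not> black (a, b)" "(a - 1, b) \<in> set T"
    and "(a, b) \<notin> set T" "(a - 1, b - 1) \<notin> set T"
  shows "hd T = (a - 1, b) \<or> last T = (a - 1, b)"
proof (rule ccontr)
  assume neq: "\<not> ?thesis"
  have "(a, b - 1) \<notin> set T" using not_both_antidiagonal[of "a - 1" b] assms(2) by auto
  then have "num_neighbours T (a, b) = 2" using assms by (auto simp: num_neighbours_eq)
  moreover have "hd T \<noteq> (a, b)" "hd T \<noteq> (a, b - 1)" "last T \<noteq> (a - 1, b - 1)" "last T \<noteq> (a, b - 1)"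
    using hd_in last_in assms \<open>(a, b - 1) \<notin> set T\<close> by metis+
  ultimately have "is_turn T (a, b)"
    using neq assms(2) by (simp add: is_turn_def verts_iff corner_eq_iff)
  then show False using turns_black assms(1) by blast
qed

text \<open>Consequently a white vertex lies on one tile or on two tiles that share an edge.\<close>

lemma white_tiles:
  assumes "\<not> black (a, b)"
  shows "\<not> ((a, b) \<in> set T \<and> (a - 1, b - 1) \<in> set T)"
    and "\<not> ((a - 1, b) \<in> set T \<and> (a, b - 1) \<in> set T)"
  using white_not_inner_corner[OF assms] not_both_antidiagonal[of "a - 1" b] by auto

text \<open>Edges on both sides need tiles on both sides; as diagonal pairs are excluded, the two
  tiles lie next to each other on one side of the line, and both edges are outer edges of tiles
  adjacent in that direction.\<close>

lemma white_straight_rails: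
  assumes "\<not> black (a, b)"
  shows "{(a, b), (a - 1, b)} \<in> edges T \<Longrightarrow> {(a, b), (a + 1, b)} \<in> edges T \<Longrightarrow>
      {(a, b), (a - 1, b)} \<in> rails T \<and> {(a, b), (a + 1, b)} \<in> rails T"
    and "{(a, b), (a, b - 1)} \<in> edges T \<Longrightarrow> {(a, b), (a, b + 1)} \<in> edges T \<Longrightarrow>
      {(a, b), (a, b - 1)} \<in> rails T \<and> {(a, b), (a, b + 1)} \<in> rails T"
  using white_tiles[OF assms]
  unfolding edge_left edge_right edge_up edge_down rail_left rail_right rail_up rail_down
  by argo+

lemma white_corner_tile:
  assumes "\<not> black (a, b)"
  shows "{(a, b), (a + 1, b)} \<in> edges T \<Longrightarrow> {(a, b), (a, b + 1)} \<in> edges T \<Longrightarrow> (a, b) \<in> set T"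
    and "{(a, b), (a + 1, b)} \<in> edges T \<Longrightarrow> {(a, b), (a, b - 1)} \<in> edges T \<Longrightarrow> (a, b - 1) \<in> set T"
    and "{(a, b), (a - 1, b)} \<in> edges T \<Longrightarrow> {(a, b), (a, b + 1)} \<in> edges T \<Longrightarrow> (a - 1, b) \<in> set T"
    and "{(a, b), (a - 1, b)} \<in> edges T \<Longrightarrow> {(a, b), (a, b - 1)} \<in> edges T \<Longrightarrow> (a - 1, b - 1) \<in> set T"
  using white_tiles[OF assms] unfolding edge_left edge_right edge_up edge_down by argo+

text \<open>The boundary bends at inner corners, excluded by \<open>white_tiles\<close>, and at
  outer corners, where the tile is first or last and lacks a neighbour that one of the two rails
  would require.\<close>

lemma white_corner_no_rails:
  assumes "\<not> black (a, b)"
  shows "\<not> ({(a, b), (a + 1, b)} \<in> rails T \<and> {(a, b), (a, b + 1)} \<in> rails T)"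
    and "\<not> ({(a, b), (a + 1, b)} \<in> rails T \<and> {(a, b), (a, b - 1)} \<in> rails T)"
    and "\<not> ({(a, b), (a - 1, b)} \<in> rails T \<and> {(a, b), (a, b + 1)} \<in> rails T)"
    and "\<not> ({(a, b), (a - 1, b)} \<in> rails T \<and> {(a, b), (a, b - 1)} \<in> rails T)"
proof -
  have anti: "\<not> ((a + 1, b) \<in> set T \<and> (a, b + 1) \<in> set T)"
      "\<not> ((a - 2, b - 1) \<in> set T \<and> (a - 1, b - 2) \<in> set T)"
    using not_both_succ[of a b] not_both_antidiagonal[of "a - 2" "b - 1"] by auto
  have single: "(a, b) \<in> set T \<longrightarrow> length T = 1 \<longrightarrow>
      (a, b + 1) \<notin> set T \<and> (a, b - 1) \<notin> set T"
    "(a - 1, b - 1) \<in> set T \<longrightarrow> length T = 1 \<longrightarrow>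
      (a - 1, b) \<notin> set T \<and> (a - 1, b - 2) \<notin> set T"
    "(a - 1, b) \<in> set T \<longrightarrow> length T = 1 \<longrightarrow>
      (a - 1, b + 1) \<notin> set T \<and> (a - 1, b - 1) \<notin> set T"
    "(a, b - 1) \<in> set T \<longrightarrow> length T = 1 \<longrightarrow>
      (a, b) \<notin> set T \<and> (a, b - 2) \<notin> set T"
    using single_tile[of "(a, b)" "(a, b + 1)"] single_tile[of "(a, b)" "(a, b - 1)"]
      single_tile[of "(a - 1, b - 1)" "(a - 1, b)"] single_tile[of "(a - 1, b - 1)" "(a - 1, b - 2)"]
      single_tile[of "(a - 1, b)" "(a - 1, b + 1)"] single_tile[of "(a - 1, b)" "(a - 1, b - 1)"]
      single_tile[of "(a, b - 1)" "(a, b)"] single_tile[of "(a, b - 1)" "(a, b - 2)"]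
    by auto
  \<comment> \<open>A first tile has no tile to its left and a last tile none above it.\<close>
  have upper: "(a - 1, b) \<in> set T \<longrightarrow> (a, b) \<notin> set T \<longrightarrow> (a - 1, b - 1) \<notin> set T \<longrightarrow>
      (a - 2, b) \<notin> set T \<or> (a - 1, b + 1) \<notin> set T"
    using white_outer_corner_lower[OF assms] hd_iff[of "a - 1" b] last_iff[of "a - 1" b] by auto
  have lower: "(a, b - 1) \<in> set T \<longrightarrow> (a, b) \<notin> set T \<longrightarrow> (a - 1, b - 1) \<notin> set T \<longrightarrow>
      (a + 1, b - 1) \<notin> set T \<or> (a, b - 2) \<notin> set T"
    using white_outer_corner_upper[OF assms] hd_iff[of a "b - 1"] last_iff[of a "b - 1"] by auto
  show "\<not> ({(a, b), (a + 1, b)} \<in> rails T \<and> {(a, b), (a, b + 1)} \<in> rails T)"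
    using white_tiles[OF assms] anti single unfolding rail_right rail_up by argo
  show "\<not> ({(a, b), (a + 1, b)} \<in> rails T \<and> {(a, b), (a, b - 1)} \<in> rails T)"
    using white_tiles[OF assms] single lower unfolding rail_right rail_down by argo
  show "\<not> ({(a, b), (a - 1, b)} \<in> rails T \<and> {(a, b), (a, b + 1)} \<in> rails T)"
    using white_tiles[OF assms] single upper unfolding rail_left rail_up by argo
  show "\<not> ({(a, b), (a - 1, b)} \<in> rails T \<and> {(a, b), (a, b - 1)} \<in> rails T)"
    using white_tiles[OF assms] anti single unfolding rail_left rail_down by argo
qed

lemma two_edges_cases:
  assumes "{(a, b), u} \<in> edges T" "{(a, b), v} \<in> edges T" "u \<noteq> v"
  obtains (horizontal) "{u, v} = {(a - 1, b), (a + 1, b)}"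
  | (vertical) "{u, v} = {(a, b - 1), (a, b + 1)}"
  | (corner) p q where "{u, v} = {p, q}" "p \<in> {(a + 1, b), (a - 1, b)}" "q \<in> {(a, b + 1), (a, b - 1)}"
proof -
  let ?H = "{(a + 1, b), (a - 1, b)}" and ?V = "{(a, b + 1), (a, b - 1)}"
  have "u \<in> ?H \<union> ?V" "v \<in> ?H \<union> ?V"
    using edge_cases[OF assms(1)] edge_cases[OF assms(2)] by auto
  then consider "u \<in> ?H" "v \<in> ?H" | "u \<in> ?V" "v \<in> ?V" | "u \<in> ?H" "v \<in> ?V" | "u \<in> ?V" "v \<in> ?H"
    by blast
  then show thesis
  proof cases
    case 1
    then have "{u, v} = {(a - 1, b), (a + 1, b)}" using assms(3) by blast
    then show thesis by (rule horizontal)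
  next
    case 2
    then have "{u, v} = {(a, b - 1), (a, b + 1)}" using assms(3) by blast
    then show thesis by (rule vertical)
  next
    case 3
    then show thesis using corner[of u v] by blast
  next
    case 4
    then show thesis using corner[of v u] by blast
  qed
qed

end

section \<open>The entries of the Gram matrix\<close>

locale kasteleyn_snake = coloured_snake +
  fixes w :: "edge \<Rightarrow> rat"
  assumes kasteleyn: "kasteleyn T w"
begin

definition adj :: "vertex \<Rightarrow> vertex \<Rightarrow> rat" where
  "adj u v = (if {u, v} \<in> edges T then w {u, v} else 0)"

definition gram :: "vertex \<Rightarrow> vertex \<Rightarrow> rat" where
  "gram u v = (\<Sum>x | x \<in> verts T \<and> \<not> black x. adj u x * adj v x)"

lemma adj_sym: "adj u v = adj v u"
  by (simp add: adj_def insert_commute)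

lemma gram_sym: "gram u v = gram v u"
  by (simp add: gram_def mult.commute)

lemma weight_sign: "e \<in> edges T \<Longrightarrow> w e = 1 \<or> w e = -1"
  using kasteleyn by (auto simp: kasteleyn_def)

lemma weight_square: "e \<in> edges T \<Longrightarrow> w e * w e = 1"
  using weight_sign by fastforce

lemma gram_eq:
  assumes "black u"
  shows "gram u v = (\<Sum>x | {u, x} \<in> edges T \<and> {v, x} \<in> edges T. w {u, x} * w {v, x})"
proof -
  have "(\<Sum>x | {u, x} \<in> edges T \<and> {v, x} \<in> edges T. w {u, x} * w {v, x})
    = (\<Sum>x | {u, x} \<in> edges T \<and> {v, x} \<in> edges T. adj u x * adj v x)"
    by (rule sum.cong) (auto simp: adj_def)
  also have "\<dots> = gram u v"
    unfolding gram_def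
  proof (rule sum.mono_neutral_left)
    show "{x. {u, x} \<in> edges T \<and> {v, x} \<in> edges T} \<subseteq> {x. x \<in> verts T \<and> \<not> black x}"
      using edge_colours edges_subset_verts assms by blast
  qed (auto simp: adj_def finite_verts)
  finally show ?thesis by simp
qed

text \<open>Every neighbour contributes a squared sign; this is the origin of the numbers e_l in the
  linear factors.\<close>

lemma gram_self:
  assumes "black u"
  shows "gram u u = of_nat (num_neighbours T u)"
proof -
  have "{x \<in> verts T. {x, u} \<in> edges T} = {x. {u, x} \<in> edges T}"
    using edges_subset_verts by (auto simp: insert_commute)
  then show ?thesis
    by (simp add: gram_eq[OF assms] weight_square num_neighbours_def)
qed

text \<open>This is the Kasteleyn condition for a 4-cycle in multiplicative form: an odd number of
  signs -1.\<close>

lemma tile_weight: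
  assumes "(a, b) \<in> set T"
  shows "w {(a, b), (a + 1, b)} * w {(a, b + 1), (a + 1, b + 1)}
    * w {(a, b), (a, b + 1)} * w {(a + 1, b), (a + 1, b + 1)} = -1"
proof -
  let ?F = "tile_edges (a, b)"
  have F: "?F = {{(a, b), (a + 1, b)}, {(a, b + 1), (a + 1, b + 1)},
      {(a, b), (a, b + 1)}, {(a + 1, b), (a + 1, b + 1)}}"
    by (simp add: tile_edges_def corner_defs)
  have neq: "{(a, b), (a + 1, b)} \<noteq> {(a, b + 1), (a + 1, b + 1)}"
    "{(a, b), (a + 1, b)} \<noteq> {(a, b), (a, b + 1)}"
    "{(a, b), (a + 1, b)} \<noteq> {(a + 1, b), (a + 1, b + 1)}"
    "{(a, b + 1), (a + 1, b + 1)} \<noteq> {(a, b), (a, b + 1)}"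
    "{(a, b + 1), (a + 1, b + 1)} \<noteq> {(a + 1, b), (a + 1, b + 1)}"
    "{(a, b), (a, b + 1)} \<noteq> {(a + 1, b), (a + 1, b + 1)}"
    by (simp_all add: doubleton_eq_iff)
  have "card ?F = 4" using neq by (simp add: F)
  moreover have "?F \<in> face_boundaries T" using assms by (simp add: face_boundaries_def)
  ultimately have "odd (card {e \<in> ?F. w e = -1})"
    using kasteleyn by (fastforce simp: kasteleyn_def)
  moreover have "(\<Prod>e\<in>?F. w e) = (\<Prod>e\<in>?F. if w e = -1 then -1 else 1)"
    using kasteleyn assms by (intro prod.cong) (auto simp: kasteleyn_def edges_def)
  moreover have "(\<Prod>e\<in>?F. if w e = -1 then -1 else 1 :: rat) = (-1) ^ card {e \<in> ?F. w e = -1}"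
    by (subst prod.inter_filter[symmetric]) (simp_all add: F)
  ultimately have "(\<Prod>e\<in>?F. w e) = -1" by simp
  then show ?thesis using neq by (simp add: F mult.assoc)
qed

text \<open>The common neighbours are the other two corners of the tile. Their two contributions
  multiply to -1 by \<open>tile_weight\<close>, so they are opposite signs.\<close>

lemma gram_tile_diagonal:
  assumes T: "(a, b) \<in> set T" and black: "black (a, b)"
  shows "gram (a, b) (a + 1, b + 1) = 0"
proof -
  have E: "{(a, b), (a + 1, b)} \<in> edges T" "{(a, b), (a, b + 1)} \<in> edges T"
    "{(a, b + 1), (a + 1, b + 1)} \<in> edges T" "{(a + 1, b), (a + 1, b + 1)} \<in> edges T"
    using T horizontal_edge[of a b] horizontal_edge[of a "b + 1"]
      vertical_edge[of a b] vertical_edge[of "a + 1" b] by simp_all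
  then have E': "{(a, b), (a + 1, b)} \<in> edges T" "{(a + 1, b + 1), (a + 1, b)} \<in> edges T"
    "{(a, b), (a, b + 1)} \<in> edges T" "{(a + 1, b + 1), (a, b + 1)} \<in> edges T"
    by (simp_all add: insert_commute)
  have "x = (a + 1, b) \<or> x = (a, b + 1)" if "{(a, b), x} \<in> edges T" "{(a + 1, b + 1), x} \<in> edges T" for x
    using edge_cases[OF that(1)] edge_cases[OF that(2)] by auto
  then have "{x. {(a, b), x} \<in> edges T \<and> {(a + 1, b + 1), x} \<in> edges T} = {(a + 1, b), (a, b + 1)}"
    using E' by blast
  then have "gram (a, b) (a + 1, b + 1) = w {(a, b), (a + 1, b)} * w {(a + 1, b), (a + 1, b + 1)}
      + w {(a, b), (a, b + 1)} * w {(a, b + 1), (a + 1, b + 1)}"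
    by (simp add: gram_eq[OF black] insert_commute)
  then show ?thesis
    using tile_weight[OF T] E[THEN weight_sign] by auto
qed

lemma gram_tile_antidiagonal:
  assumes T: "(a, b) \<in> set T" and black: "black (a + 1, b)"
  shows "gram (a + 1, b) (a, b + 1) = 0"
proof -
  have E: "{(a, b), (a + 1, b)} \<in> edges T" "{(a, b), (a, b + 1)} \<in> edges T"
    "{(a, b + 1), (a + 1, b + 1)} \<in> edges T" "{(a + 1, b), (a + 1, b + 1)} \<in> edges T"
    using T horizontal_edge[of a b] horizontal_edge[of a "b + 1"]
      vertical_edge[of a b] vertical_edge[of "a + 1" b] by simp_all
  then have E': "{(a + 1, b), (a, b)} \<in> edges T" "{(a, b + 1), (a, b)} \<in> edges T"
    "{(a + 1, b), (a + 1, b + 1)} \<in> edges T" "{(a, b + 1), (a + 1, b + 1)} \<in> edges T"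
    by (simp_all add: insert_commute)
  have "x = (a, b) \<or> x = (a + 1, b + 1)" if "{(a + 1, b), x} \<in> edges T" "{(a, b + 1), x} \<in> edges T" for x
    using edge_cases[OF that(1)] edge_cases[OF that(2)] by auto
  then have "{x. {(a + 1, b), x} \<in> edges T \<and> {(a, b + 1), x} \<in> edges T} = {(a, b), (a + 1, b + 1)}"
    using E' by blast
  then have "gram (a + 1, b) (a, b + 1) = w {(a, b), (a + 1, b)} * w {(a, b), (a, b + 1)}
      + w {(a + 1, b), (a + 1, b + 1)} * w {(a, b + 1), (a + 1, b + 1)}"
    by (simp add: gram_eq[OF black] insert_commute)
  then show ?thesis
    using tile_weight[OF T] E[THEN weight_sign] by auto
qed

text \<open>The square filling the angle at the white vertex is a tile by
  \<open>white_corner_tile\<close>, and \<open>p\<close>, \<open>q\<close> are opposite corners of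
  it.\<close>

lemma gram_corner:
  assumes "\<not> black (a, b)" "{(a, b), p} \<in> edges T" "{(a, b), q} \<in> edges T"
    and "p \<in> {(a + 1, b), (a - 1, b)}" "q \<in> {(a, b + 1), (a, b - 1)}"
  shows "gram p q = 0"
proof -
  have black: "black p" "black q" using assms edge_colours by blast+
  note tiles = white_corner_tile[OF assms(1)]
  consider "p = (a + 1, b)" "q = (a, b + 1)" | "p = (a + 1, b)" "q = (a, b - 1)"
    | "p = (a - 1, b)" "q = (a, b + 1)" | "p = (a - 1, b)" "q = (a, b - 1)"
    using assms(4,5) by blast
  then show ?thesis
  proof cases
    case 1
    then show ?thesis using gram_tile_antidiagonal[of a b] tiles(1) assms black by simp
  next
    case 2
    then show ?thesis using gram_tile_diagonal[of a "b - 1"] tiles(2) assms black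
      by (simp add: gram_sym[of "(a + 1, b)"])
  next
    case 3
    then show ?thesis using gram_tile_diagonal[of "a - 1" b] tiles(3) assms black by simp
  next
    case 4
    then show ?thesis using gram_tile_antidiagonal[of "a - 1" "b - 1"] tiles(4) assms black
      by (simp add: gram_sym[of "(a - 1, b)"])
  qed
qed

text \<open>A common neighbour at which the connection bends would make the entry vanish, so it runs
  straight and therefore along rails.\<close>

lemma gram_nonzero_rails:
  assumes "black u" "u \<noteq> v" "gram u v \<noteq> 0"
  shows "\<exists>x. \<not> black x \<and> {u, x} \<in> rails T \<and> {x, v} \<in> rails T"
proof -
  have "{x. {u, x} \<in> edges T \<and> {v, x} \<in> edges T} \<noteq> {}"
  proof
    assume empty: "{x. {u, x} \<in> edges T \<and> {v, x} \<in> edges T} = {}"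
    then show False using assms(3) by (simp only: gram_eq[OF assms(1)] empty sum.empty)
  qed
  then obtain x where "{u, x} \<in> edges T" "{v, x} \<in> edges T" by blast
  moreover obtain a b where "x = (a, b)" by fastforce
  ultimately have e: "{(a, b), u} \<in> edges T" "{(a, b), v} \<in> edges T"
    by (simp_all add: insert_commute)
  have white: "\<not> black (a, b)" using edge_colours[OF e(1)] assms(1) by simp
  have "{(a, b), u} \<in> rails T \<and> {(a, b), v} \<in> rails T"
    using e assms(2)
  proof (cases rule: two_edges_cases)
    case horizontal
    then show ?thesis using white_straight_rails(1)[OF white] e by (auto simp: doubleton_eq_iff)
  next
    case vertical
    then show ?thesis using white_straight_rails(2)[OF white] e by (auto simp: doubleton_eq_iff)
  next
    case (corner p q)
    then have "gram p q = 0" using gram_corner[OF white _ _ corner(2,3)] e by (auto simp: doubleton_eq_iff)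
    then show ?thesis using corner(1) assms(3) gram_sym[of u v] by (auto simp: doubleton_eq_iff)
  qed
  then show ?thesis using white by (auto simp: insert_commute)
qed

lemma gram_unit_of_single_common_neighbour:
  assumes "black u" "{u, x} \<in> edges T" "{v, x} \<in> edges T"
    and "\<And>y. {u, y} \<in> edges T \<Longrightarrow> {v, y} \<in> edges T \<Longrightarrow> y = x"
  shows "gram u v * gram v u = 1"
proof -
  have "{y. {u, y} \<in> edges T \<and> {v, y} \<in> edges T} = {x}" using assms(2-) by blast
  then have "gram u v = w {u, x} * w {v, x}" by (simp add: gram_eq[OF assms(1)])
  moreover have "(w {u, x} * w {v, x}) * (w {u, x} * w {v, x}) = 1"
    using weight_sign[OF assms(2)] weight_sign[OF assms(3)] by auto
  ultimately show ?thesis using gram_sym by metis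
qed

text \<open>Rails run straight through \<open>x\<close>, and two points at distance 2 on a line have
  only the midpoint as common neighbour. The entry is then one product of signs, and symmetry makes
  the claimed product its square.\<close>

lemma gram_rails:
  assumes "\<not> black x" "{u, x} \<in> rails T" "{x, v} \<in> rails T" "u \<noteq> v"
  shows "gram u v * gram v u = 1"
proof -
  obtain a b where x: "x = (a, b)" by fastforce
  have r: "{(a, b), u} \<in> rails T" "{(a, b), v} \<in> rails T"
    using assms(2,3) x by (simp_all add: insert_commute)
  then have e: "{(a, b), u} \<in> edges T" "{(a, b), v} \<in> edges T"
    using rails_subset_edges by blast+
  have white: "\<not> black (a, b)" using assms(1) x by simp
  have u: "black u" using edge_colours[OF e(1)] white by simp
  have e': "{u, (a, b)} \<in> edges T" "{v, (a, b)} \<in> edges T"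
    using e by (simp_all add: insert_commute)
  show ?thesis
    using e assms(4)
  proof (cases rule: two_edges_cases)
    case horizontal
    then consider "u = (a - 1, b)" "v = (a + 1, b)" | "u = (a + 1, b)" "v = (a - 1, b)"
      unfolding doubleton_eq_iff by blast
    then have "y = (a, b)" if "{u, y} \<in> edges T" "{v, y} \<in> edges T" for y
      by cases (use that edge_cases[of "a - 1" b y T] edge_cases[of "a + 1" b y T] in auto)
    then show ?thesis by (rule gram_unit_of_single_common_neighbour[OF u e'])
  next
    case vertical
    then consider "u = (a, b - 1)" "v = (a, b + 1)" | "u = (a, b + 1)" "v = (a, b - 1)"
      unfolding doubleton_eq_iff by blast
    then have "y = (a, b)" if "{u, y} \<in> edges T" "{v, y} \<in> edges T" for y
      by cases (use that edge_cases[of a "b - 1" y T] edge_cases[of a "b + 1" y T] in auto)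
    then show ?thesis by (rule gram_unit_of_single_common_neighbour[OF u e'])
  next
    case (corner p q)
    then have "{(a, b), p} \<in> rails T" "{(a, b), q} \<in> rails T"
      using r by (auto simp: doubleton_eq_iff)
    then show ?thesis using white_corner_no_rails[OF white] corner(2,3) by auto
  qed
qed

end

section \<open>Equally many black and white vertices\<close>

lemma snake_butlast: "snake (T @ [t]) \<Longrightarrow> T \<noteq> [] \<Longrightarrow> snake T"
proof -
  assume snake: "snake (T @ [t])" and "T \<noteq> []"
  have "T ! Suc i = right_of (T ! i) \<or> T ! Suc i = above (T ! i)" if "Suc i < length T" for i
    using snake that unfolding snake_def by (elim conjE allE[of _ i]) (simp add: nth_append)
  with \<open>T \<noteq> []\<close> show "snake T" by (simp add: snake_def)
qed

lemma verts_append: "verts (T @ [t]) = verts T \<union> tile_vertices t"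
  by (auto simp: verts_def)

lemma edges_append: "edges (T @ [t]) = edges T \<union> tile_edges t"
  by (auto simp: edges_def)

lemma card_filter_insert_pair:
  assumes "finite V" "p \<notin> V" "q \<notin> V" "P p \<longleftrightarrow> \<not> P q"
  shows "card {v \<in> V \<union> {p, q}. P v} = Suc (card {v \<in> V. P v})"
proof -
  have "{v \<in> V \<union> {p, q}. P v} = insert (if P p then p else q) {v \<in> V. P v}"
    using assms(4) by auto
  then show ?thesis using assms(1-3) by simp
qed

text \<open>An appended tile shares one edge with the old graph, and the opposite edge is new. Its
  ends have different colours, which drives the counting of the colour classes.\<close>

lemma new_vertices:
  assumes "snake (T @ [t])" "T \<noteq> []"
  obtains p q where "verts (T @ [t]) = verts T \<union> {p, q}" "p \<notin> verts T" "q \<notin> verts T"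
    "{p, q} \<in> edges (T @ [t])"
proof -
  interpret snake_graph T
    using snake_butlast[OF assms] by unfold_locales
  obtain a b where l: "last T = (a, b)" by fastforce
  then have ab: "(a, b) \<in> set T" using last_in by simp
  \<comment> \<open>All old tiles lie weakly below and to the left of the last one, so vertices with
    a coordinate 2 beyond its lower-left corner are new.\<close>
  have bound: "c \<le> a \<and> d \<le> b" if "(c, d) \<in> set T" for c d
    using tiles_mono[OF that ab] last_level[OF that] l by simp
  have "(T @ [t]) ! Suc (length T - 1) = right_of ((T @ [t]) ! (length T - 1)) \<or>
      (T @ [t]) ! Suc (length T - 1) = above ((T @ [t]) ! (length T - 1))"
    using assms unfolding snake_def by (elim conjE allE[of _ "length T - 1"]) simp
  then have "t = (a + 1, b) \<or> t = (a, b + 1)"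
    using assms(2) l by (simp add: nth_append last_conv_nth right_of_def above_def)
  then show thesis
  proof
    assume t: "t = (a + 1, b)"
    show thesis
    proof (rule that[of "(a + 2, b)" "(a + 2, b + 1)"])
      have "(a + 1, b) \<in> verts T" "(a + 1, b + 1) \<in> verts T" using ab by (simp_all add: verts_iff)
      then show "verts (T @ [t]) = verts T \<union> {(a + 2, b), (a + 2, b + 1)}"
        by (auto simp: verts_append t tile_vertices_def corner_defs)
      show "(a + 2, b) \<notin> verts T" "(a + 2, b + 1) \<notin> verts T"
        using bound by (fastforce simp: verts_iff)+
    qed (simp add: vertical_edge t)
  next
    assume t: "t = (a, b + 1)"
    show thesis
    proof (rule that[of "(a, b + 2)" "(a + 1, b + 2)"])
      have "(a, b + 1) \<in> verts T" "(a + 1, b + 1) \<in> verts T" using ab by (simp_all add: verts_iff)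
      then show "verts (T @ [t]) = verts T \<union> {(a, b + 2), (a + 1, b + 2)}"
        by (auto simp: verts_append t tile_vertices_def corner_defs)
      show "(a, b + 2) \<notin> verts T" "(a + 1, b + 2) \<notin> verts T"
        using bound by (fastforce simp: verts_iff)+
    qed (simp add: horizontal_edge t)
  qed
qed

lemma card_black_eq_card_white:
  assumes "snake T" "proper_colouring T black"
  shows "card {v \<in> verts T. black v} = card {v \<in> verts T. \<not> black v}"
  using assms
proof (induction T rule: rev_induct)
  case Nil
  then show ?case by (simp add: snake_def)
next
  case (snoc t T)
  have colours: "black u \<longleftrightarrow> \<not> black v" if "{u, v} \<in> edges (T @ [t])" for u v
    using snoc.prems(2) edges_subset_verts[OF that] that by (auto simp: proper_colouring_def)
  show ?case
  proof (cases "T = []")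
    case True
    obtain a b where t: "t = (a, b)" by fastforce
    \<comment> \<open>The first tile is treated as two added pairs as well, namely its bottom and
      its top edge.\<close>
    have V: "verts (T @ [t]) = {} \<union> {(a, b), (a + 1, b)} \<union> {(a, b + 1), (a + 1, b + 1)}"
      by (auto simp: True verts_def t tile_vertices_def corner_defs)
    have E: "{(a, b), (a + 1, b)} \<in> edges (T @ [t])" "{(a, b + 1), (a + 1, b + 1)} \<in> edges (T @ [t])"
      by (simp_all add: True edges_def t tile_edges_def corner_defs)
    show ?thesis
      unfolding V using colours[OF E(1)] colours[OF E(2)]
      by (subst (1 2) card_filter_insert_pair; (subst (1 2) card_filter_insert_pair)?; auto)
  next
    case False
    obtain p q where pq: "verts (T @ [t]) = verts T \<union> {p, q}" "p \<notin> verts T" "q \<notin> verts T"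
      "{p, q} \<in> edges (T @ [t])"
      using new_vertices[OF snoc.prems(1) False] .
    have "proper_colouring T black"
      using colours by (auto simp: proper_colouring_def edges_append)
    then have "card {v \<in> verts T. black v} = card {v \<in> verts T. \<not> black v}"
      using snoc.IH snake_butlast[OF snoc.prems(1) False] by simp
    moreover have "card {v \<in> verts T \<union> {p, q}. black v} = Suc (card {v \<in> verts T. black v})"
      by (rule card_filter_insert_pair) (use pq colours[OF pq(4)] finite_verts in auto)
    moreover have "card {v \<in> verts T \<union> {p, q}. \<not> black v} = Suc (card {v \<in> verts T. \<not> black v})"
      by (rule card_filter_insert_pair) (use pq colours[OF pq(4)] finite_verts in auto)
    ultimately show ?thesis unfolding pq(1) by (simp only:)
  qed
qed

section \<open>Black vertices along a path\<close>

lemma path_edges_simps [simp]: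
  "path_edges [] = {}"
  "path_edges [x] = {}"
  "path_edges (x # y # zs) = insert {x, y} (path_edges (y # zs))"
proof -
  show "path_edges (x # y # zs) = insert {x, y} (path_edges (y # zs))"
  proof (rule equalityI; rule subsetI)
    fix e
    assume "e \<in> path_edges (x # y # zs)"
    then obtain i where "Suc i < length (x # y # zs)" "e = {(x # y # zs) ! i, (x # y # zs) ! Suc i}"
      by (auto simp: path_edges_def)
    then show "e \<in> insert {x, y} (path_edges (y # zs))"
      by (cases i) (auto simp: path_edges_def)
  next
    fix e
    assume "e \<in> insert {x, y} (path_edges (y # zs))"
    then consider "e = {x, y}" | i where "Suc i < length (y # zs)" "e = {(y # zs) ! i, (y # zs) ! Suc i}"
      by (auto simp: path_edges_def)
    then show "e \<in> path_edges (x # y # zs)"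
    proof cases
      case 1
      then show ?thesis by (force simp: path_edges_def)
    next
      case 2
      then show ?thesis unfolding path_edges_def by (intro CollectI exI[of _ "Suc i"]) simp
    qed
  qed
qed (simp_all add: path_edges_def)

lemma path_edges_subset: "e \<in> path_edges ps \<Longrightarrow> e \<subseteq> set ps"
  by (induction ps rule: induct_list012) auto

lemma path_edges_Cons_mono: "path_edges ps \<subseteq> path_edges (x # ps)"
  by (cases ps) auto

lemma vertex_in_path_edge:
  "path_edges ps \<noteq> {} \<Longrightarrow> v \<in> set ps \<Longrightarrow> \<exists>u. {u, v} \<in> path_edges ps"
proof (induction ps rule: induct_list012)
  case (3 x y zs)
  then consider "v = x" | "v = y" | "v \<in> set zs" by auto
  then show ?case
  proof cases
    case 1
    then show ?thesis by (intro exI[of _ y]) (simp add: insert_commute)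
  next
    case 2
    then show ?thesis by (intro exI[of _ x]) simp
  next
    case 3
    then have "path_edges (y # zs) \<noteq> {}" by (cases zs) simp_all
    then have "\<exists>u. {u, v} \<in> path_edges (y # zs)" using "3.IH"(2) 3 by simp
    then show ?thesis by auto
  qed
qed simp_all

lemma interior_path_vertex:
  "distinct ps \<Longrightarrow> x \<in> set ps \<Longrightarrow> x \<noteq> hd ps \<Longrightarrow> x \<noteq> last ps \<Longrightarrow>
    \<exists>u v. u \<noteq> v \<and> {x, u} \<in> path_edges ps \<and> {x, v} \<in> path_edges ps"
proof (induction ps rule: induct_list012)
  case (3 a b cs)
  show ?case
  proof (cases "x = b")
    case True
    then obtain c cs' where "cs = c # cs'" using 3 by (cases cs) auto
    then show ?thesis using True "3.prems"(1)
      by (intro exI[of _ a] exI[of _ c]) (auto simp: insert_commute)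
  next
    case False
    then have "\<exists>u v. u \<noteq> v \<and> {x, u} \<in> path_edges (b # cs) \<and> {x, v} \<in> path_edges (b # cs)"
      using 3 by (intro "3.IH"(2)) auto
    then show ?thesis by auto
  qed
qed simp_all

text \<open>As membership in \<open>P\<close> alternates along the path, consecutive
  \<open>P\<close>-vertices are two steps apart with one vertex between them, and \<open>f\<close>
  vanishes between distinct \<open>P\<close>-vertices that are not linked in this way.\<close>

lemma unit_tridiagonal_filter:
  assumes "distinct ps"
    and "\<And>u v. {u, v} \<in> path_edges ps \<Longrightarrow> P u \<longleftrightarrow> \<not> P v"
    and "\<And>u v. u \<in> set ps \<Longrightarrow> v \<in> set ps \<Longrightarrow> P u \<Longrightarrow> P v \<Longrightarrow> u \<noteq> v \<Longrightarrow> f u v \<noteq> 0 \<Longrightarrow>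
      \<exists>x. \<not> P x \<and> {u, x} \<in> path_edges ps \<and> {x, v} \<in> path_edges ps"
    and "\<And>u x v. \<not> P x \<Longrightarrow> {u, x} \<in> path_edges ps \<Longrightarrow> {x, v} \<in> path_edges ps \<Longrightarrow> u \<noteq> v \<Longrightarrow>
      f u v * f v u = 1"
  shows "unit_tridiagonal f (filter P ps)"
  using assms
proof (induction ps)
  case (Cons x ps)
  note alt = Cons.prems(2) and step = Cons.prems(3) and unit = Cons.prems(4)
  have x: "x \<notin> set ps" using Cons.prems(1) by simp
  have new: "e \<in> path_edges ps" if "e \<in> path_edges (x # ps)" "x \<notin> e" for e
    using that by (cases ps) auto
  have only: "v = hd ps" if "{x, v} \<in> path_edges (x # ps)" for v
    using that x path_edges_subset[of "{x, v}" ps] by (cases ps) (auto simp: doubleton_eq_iff)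
  have IH: "unit_tridiagonal f (filter P ps)"
  proof (rule Cons.IH)
    show "distinct ps" using Cons.prems(1) by simp
    show "P u \<longleftrightarrow> \<not> P v" if "{u, v} \<in> path_edges ps" for u v
      using alt that path_edges_Cons_mono by blast
    show "f u v * f v u = 1" if "\<not> P y" "{u, y} \<in> path_edges ps" "{y, v} \<in> path_edges ps" "u \<noteq> v" for u y v
      using unit that path_edges_Cons_mono by blast
    fix u v
    assume uv: "u \<in> set ps" "v \<in> set ps" "P u" "P v" "u \<noteq> v" "f u v \<noteq> 0"
    then obtain y where y: "\<not> P y" "{u, y} \<in> path_edges (x # ps)" "{y, v} \<in> path_edges (x # ps)"
      using step[of u v] by auto
    \<comment> \<open>The head \<open>x\<close> has only one neighbour on the path, so it cannot
      link two different vertices.\<close>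
    have "y \<noteq> x"
    proof
      assume "y = x"
      then have "u = hd ps" "v = hd ps"
        using y only[of u] only[of v] by (simp_all add: insert_commute)
      then show False using uv(5) by simp
    qed
    moreover have "u \<noteq> x" "v \<noteq> x" using uv x by auto
    ultimately show "\<exists>y. \<not> P y \<and> {u, y} \<in> path_edges ps \<and> {y, v} \<in> path_edges ps"
      using new y by (intro exI[of _ y]) simp
  qed
  show ?case
  proof (cases "P x \<and> filter P ps \<noteq> []")
    case False
    then show ?thesis using IH by auto
  next
    case True
    then obtain y qs where ps: "ps = y # qs" by (cases ps) auto
    have y: "\<not> P y" using alt[of x y] True ps by simp
    then have "filter P qs \<noteq> []" using True ps by simp
    then obtain z rs where qs: "qs = z # rs" by (cases qs) auto
    have z: "P z" using alt[of y z] y ps qs by simp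
    have dist: "distinct (x # y # z # rs)" using Cons.prems(1) ps qs by simp
    have unit_z: "f x z * f z x = 1"
      using unit[of y x z] y ps qs dist by simp
    \<comment> \<open>A vertex linking \<open>x\<close> to \<open>e\<close> must be
      \<open>y\<close>, the only path neighbour of \<open>x\<close>; but the path neighbours of
      \<open>y\<close> are \<open>x\<close> and \<open>z\<close>, and \<open>e\<close> comes
      later.\<close>
    have zero: "f x e = 0 \<and> f e x = 0" if e: "e \<in> set rs" "P e" for e
    proof -
      have no_path: False if "\<not> P s" "{x, s} \<in> path_edges (x # ps)" "{s, e} \<in> path_edges (x # ps)" for s
      proof -
        have "s = y" using only[OF that(2)] ps by simp
        then have "{y, e} \<in> path_edges (y # z # rs)"
          using that(3) ps qs dist e by (auto simp: doubleton_eq_iff)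
        moreover have "{y, e} \<notin> path_edges (z # rs)"
          using path_edges_subset[of "{y, e}" "z # rs"] dist by auto
        ultimately show False using dist e by (auto simp: doubleton_eq_iff)
      qed
      have mem: "x \<in> set (x # ps)" "e \<in> set (x # ps)" "P x" "x \<noteq> e"
        using e True ps qs dist by auto
      have "f x e = 0"
      proof (rule ccontr)
        assume "f x e \<noteq> 0"
        then show False using step[of x e] mem e(2) no_path by blast
      qed
      moreover have "f e x = 0"
      proof (rule ccontr)
        assume "f e x \<noteq> 0"
        then obtain s where "\<not> P s" "{e, s} \<in> path_edges (x # ps)" "{s, x} \<in> path_edges (x # ps)"
          using step[of e x] mem e(2) by blast
        then show False using no_path[of s] by (simp add: insert_commute)
      qed
      ultimately show ?thesis ..
    qed
    show ?thesis using True IH y z ps qs unit_z zero by simp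
  qed
qed simp

section \<open>The boundary paths and the characteristic polynomials\<close>

context snake_graph
begin

text \<open>If one of the paths had no edge, the other would have to contain the four ends of the start and
  end edges as its own ends.\<close>

lemma path_edges_nonempty:
  assumes "length T \<noteq> 1" "distinct ls" "path_edges us \<union> path_edges ls = rails T"
  shows "path_edges us \<noteq> {}"
proof
  assume "path_edges us = {}"
  with assms(3) have ls: "path_edges ls = rails T" by simp
  let ?D = "start_edge T \<union> end_edge T"
  have "?D \<subseteq> {hd ls, last ls}"
  proof
    fix x
    assume x: "x \<in> ?D"
    then have "x \<in> verts T" using card_start_end(2)[OF assms(1)] by blast
    then obtain v where "{x, v} \<in> path_edges ls"
      using vertex_in_rail[of "fst x" "snd x"] ls by auto
    then have "x \<in> set ls" using path_edges_subset by blast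
    then show "x \<in> {hd ls, last ls}"
      using interior_path_vertex[OF assms(2)] start_end_degree[OF assms(1) x] ls by blast
  qed
  then have "card ?D \<le> card {hd ls, last ls}" by (rule card_mono[rotated]) simp
  also have "\<dots> \<le> 2" by (simp add: card_insert_if)
  finally show False using card_start_end(1)[OF assms(1)] by simp
qed

end

locale bounded_snake = kasteleyn_snake +
  fixes us ls vs :: "vertex list"
  assumes paths: "boundary_paths T us ls"
    and distinct_vs: "distinct vs" and set_vs: "set vs = verts T"
begin

lemma distinct_paths: "distinct us" "distinct ls" "set us \<inter> set ls = {}"
  using paths by (auto simp: boundary_paths_def)

lemma path_edges_eq_rails: "path_edges us \<union> path_edges ls = rails T"
  using paths by (auto simp: boundary_paths_def rails_def split: if_splits)

lemma path_edges_not_empty: "path_edges us \<noteq> {}" "path_edges ls \<noteq> {}"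
proof -
  have "path_edges us \<noteq> {} \<and> path_edges ls \<noteq> {}"
  proof (cases "length T = 1")
    case True
    then show ?thesis using paths by (auto simp: boundary_paths_def)
  next
    case False
    then show ?thesis
      using path_edges_nonempty[OF False, of ls us] path_edges_nonempty[OF False, of us ls]
        distinct_paths path_edges_eq_rails by (simp add: Un_commute)
  qed
  then show "path_edges us \<noteq> {}" "path_edges ls \<noteq> {}" by simp_all
qed

text \<open>A one-vertex list has no path edges and could hold a foreign point; since both lists do
  have edges, each listed vertex is an end of a rail. Conversely every vertex lies on a
  rail.\<close>

lemma set_paths: "set us \<union> set ls = verts T"
proof
  have "v \<in> verts T" if "{u, v} \<in> path_edges us \<union> path_edges ls" for u v
    using that path_edges_eq_rails rails_subset_edges edges_subset_verts by blast
  then show "set us \<union> set ls \<subseteq> verts T"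
    using vertex_in_path_edge path_edges_not_empty by blast
  show "verts T \<subseteq> set us \<union> set ls"
  proof
    fix x
    assume "x \<in> verts T"
    then obtain v where "{x, v} \<in> path_edges us \<union> path_edges ls"
      using vertex_in_rail[of "fst x" "snd x"] path_edges_eq_rails by auto
    then show "x \<in> set us \<union> set ls" using path_edges_subset by blast
  qed
qed

text \<open>A nonzero entry would give a linking vertex joined by rails to both paths, hence a
  member of both disjoint lists.\<close>

lemma gram_across:
  assumes "u \<in> set us" "v \<in> set ls" "black u"
  shows "gram u v = 0"
proof (rule ccontr)
  assume "gram u v \<noteq> 0"
  moreover have "u \<noteq> v" using assms distinct_paths(3) by blast
  ultimately obtain x where "{u, x} \<in> rails T" "{x, v} \<in> rails T"
    using gram_nonzero_rails assms(3) by blast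
  then have "x \<in> set us" "x \<in> set ls"
    using assms distinct_paths(3) path_edges_eq_rails path_edges_subset by blast+
  then show False using distinct_paths(3) by blast
qed

lemma boundary_char_poly:
  assumes ps: "ps = us \<or> ps = ls"
  shows "char_poly (list_mat gram (filter black ps) (filter black ps))
      = continuant (map (c_poly T) (filter black ps))"
    and "filter black ps \<noteq> []"
proof -
  have rail: "path_edges ps \<subseteq> rails T" using ps path_edges_eq_rails by blast
  have inside: "{u, x} \<in> path_edges ps" if "u \<in> set ps" "{u, x} \<in> rails T" for u x
    using that ps path_edges_eq_rails path_edges_subset distinct_paths(3) by blast
  have dist: "distinct ps" using ps distinct_paths by blast
  have alt: "black u \<longleftrightarrow> \<not> black v" if "{u, v} \<in> path_edges ps" for u v
    using that rail rails_subset_edges edge_colours by blast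
  have "unit_tridiagonal (char_entry gram) (filter black ps)"
  proof (rule unit_tridiagonal_filter[OF dist alt])
    fix u v
    assume "u \<in> set ps" "v \<in> set ps" "black u" "black v" "u \<noteq> v" "char_entry gram u v \<noteq> 0"
    moreover from this have "gram u v \<noteq> 0" by (auto simp: char_entry_def)
    ultimately obtain x where x: "\<not> black x" "{u, x} \<in> rails T" "{v, x} \<in> rails T"
      using gram_nonzero_rails[of u v] by (auto simp: insert_commute)
    then have "{u, x} \<in> path_edges ps" "{v, x} \<in> path_edges ps"
      using inside \<open>u \<in> set ps\<close> \<open>v \<in> set ps\<close> by blast+
    then show "\<exists>x. \<not> black x \<and> {u, x} \<in> path_edges ps \<and> {x, v} \<in> path_edges ps"
      using x(1) by (intro exI[of _ x]) (simp add: insert_commute)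
  next
    fix u x v
    assume "\<not> black x" "{u, x} \<in> path_edges ps" "{x, v} \<in> path_edges ps" "u \<noteq> v"
    then have "gram u v * gram v u = 1" using gram_rails rail by blast
    \<comment> \<open>The off-diagonal entries are the negatives of the Gram entries; the two minus
      signs cancel.\<close>
    then show "char_entry gram u v * char_entry gram v u = 1"
      using \<open>u \<noteq> v\<close> by (simp add: char_entry_def one_pCons mult.commute)
  qed
  then have "char_poly (list_mat gram (filter black ps) (filter black ps))
      = continuant (map (\<lambda>u. char_entry gram u u) (filter black ps))"
    using dist by (simp add: char_poly_list_mat det_unit_tridiagonal)
  also have "map (\<lambda>u. char_entry gram u u) (filter black ps) = map (c_poly T) (filter black ps)"
    by (auto simp: char_entry_def c_poly_def gram_self)
  finally show "char_poly (list_mat gram (filter black ps) (filter black ps))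
      = continuant (map (c_poly T) (filter black ps))" .
  \<comment> \<open>The path has an edge, and one of its two ends is black; so the continued
    fraction is never the dummy value for the empty list.\<close>
  obtain x y zs where "ps = x # y # zs"
    using ps path_edges_not_empty by (cases ps rule: remdups_adj.cases) auto
  then show "filter black ps \<noteq> []" using alt[of x y] by auto
qed

abbreviation "blacks \<equiv> filter black vs"
abbreviation "whites \<equiv> filter (\<lambda>v. \<not> black v) vs"

lemma weighted_adj_mat_eq: "weighted_adj_mat T w vs = list_mat adj vs vs"
  by (auto simp: weighted_adj_mat_def list_mat_def adj_def)

lemma bipartite_adj_mat_eq: "bipartite_adj_mat T black w vs = list_mat adj blacks whites"
  by (simp add: bipartite_adj_mat_def weighted_adj_mat_eq submatrix_list_mat filter_eq_nths)

lemma bipartite_gram: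
  "list_mat adj blacks whites * transpose_mat (list_mat adj blacks whites)
    = list_mat gram blacks blacks"
  using distinct_vs set_vs
  by (simp add: list_mat_mult_transpose gram_def[abs_def])

lemma boundary_gram_mat_eq:
  "boundary_gram_mat T black w vs ps
    = list_mat gram (filter (\<lambda>v. v \<in> set ps) blacks) (filter (\<lambda>v. v \<in> set ps) blacks)"
proof -
  have "filter (\<lambda>v. v \<in> set ps) blacks = nths blacks {i. i < length blacks \<and> blacks ! i \<in> set ps}"
    by (rule filter_eq_nths)
  then show ?thesis
    by (simp only: boundary_gram_mat_def Let_def bipartite_adj_mat_eq bipartite_gram submatrix_list_mat)
qed

text \<open>The submatrix lists its vertices in the order of \<open>vs\<close>, whereas
  tridiagonality needs the order along the path; reordering leaves the characteristic polynomial
  unchanged.\<close>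

lemma boundary_gram_char_poly:
  assumes "ps = us \<or> ps = ls"
  shows "char_poly (boundary_gram_mat T black w vs ps)
    = char_poly (list_mat gram (filter black ps) (filter black ps))"
  unfolding boundary_gram_mat_eq
  by (rule char_poly_list_mat_perm)
    (use assms distinct_vs distinct_paths set_vs set_paths in auto)

lemma adj_char_poly:
  "char_poly (weighted_adj_mat T w vs)
    = (char_poly (boundary_gram_mat T black w vs us) \<circ>\<^sub>p monom 1 2)
      * (char_poly (boundary_gram_mat T black w vs ls) \<circ>\<^sub>p monom 1 2)"
proof -
  have same_colour: "adj u v = 0" if "black u \<longleftrightarrow> black v" for u v
    using edge_colours[of u v] that by (auto simp: adj_def)
  have len: "length blacks = length whites"
    using card_black_eq_card_white[OF snake proper] distinct_vs set_vs
    by (simp flip: distinct_card[of "filter _ vs"])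
  have "char_poly (weighted_adj_mat T w vs)
      = char_poly (list_mat adj (blacks @ whites) (blacks @ whites))"
    unfolding weighted_adj_mat_eq
    by (rule char_poly_list_mat_perm) (use distinct_vs in auto)
  also have "\<dots> = char_poly (list_mat gram blacks blacks) \<circ>\<^sub>p monom 1 2"
    unfolding bipartite_gram[symmetric]
    by (rule char_poly_bipartite) (use distinct_vs len adj_sym same_colour in auto)
  \<comment> \<open>The black vertices are regrouped by boundary; the blocks between the two groups
    vanish by \<open>gram_across\<close>.\<close>
  also have "char_poly (list_mat gram blacks blacks)
      = char_poly (list_mat gram (filter black us @ filter black ls) (filter black us @ filter black ls))"
    by (rule char_poly_list_mat_perm)
      (use distinct_vs set_vs distinct_paths set_paths in auto)
  also have "\<dots> = char_poly (list_mat gram (filter black us) (filter black us))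
      * char_poly (list_mat gram (filter black ls) (filter black ls))"
    by (rule char_poly_list_mat_append)
      (use distinct_paths gram_across gram_sym in auto)
  finally show ?thesis
    by (simp add: boundary_gram_char_poly pcompose_mult)
qed

lemma boundary_lowest_terms:
  assumes "ps = us \<or> ps = ls"
  shows "\<exists>p q. lowest_terms (boundary_cfrac T black ps) p q
    \<and> char_poly (boundary_gram_mat T black w vs ps) = p"
proof -
  let ?cs = "map (c_poly T) (filter black ps)"
  have "lowest_terms (neg_cfrac (map to_fract ?cs)) (continuant ?cs) (continuant (tl ?cs))"
    by (rule lowest_terms_continuant)
      (use boundary_char_poly(2)[OF assms] in \<open>auto simp: c_poly_def\<close>)
  then show ?thesis
    using boundary_gram_char_poly[OF assms] boundary_char_poly(1)[OF assms]
    by (auto simp: boundary_cfrac_def comp_def)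
qed

end

theorem theorem6p4:
  fixes T :: "(int \<times> int) list"
    and black :: "vertex \<Rightarrow> bool"
    and w :: "edge \<Rightarrow> rat"
    and vs us ls :: "vertex list"
    and A B1 B2 :: "rat mat"
  assumes "snake T"
    and "proper_colouring T black"
    and "\<forall>v. is_turn T v \<longrightarrow> black v"
    and "kasteleyn T w"
    and "distinct vs" and "set vs = verts T"
    and "boundary_paths T us ls"
    and "A = weighted_adj_mat T w vs"
    and "B1 = boundary_gram_mat T black w vs us"
    and "B2 = boundary_gram_mat T black w vs ls"
  shows "char_poly A = (char_poly B1 \<circ>\<^sub>p monom 1 2) * (char_poly B2 \<circ>\<^sub>p monom 1 2)
    \<and> (\<exists>p q. lowest_terms (boundary_cfrac T black us) p q \<and> char_poly B1 = p)
    \<and> (\<exists>p q. lowest_terms (boundary_cfrac T black ls) p q \<and> char_poly B2 = p)"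
proof -
  interpret bounded_snake T black w us ls vs
    using assms by unfold_locales auto
  show ?thesis
    unfolding assms(8-10) using adj_char_poly boundary_lowest_terms by blast
qed

end
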